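(* Let $H$ be an infinite dimensional complex Hilbert space and $T\in \mathcal{B}(H)$. Then any two of the following conditions imply the third one. (1) $T\in \overline{\mathcal{AN}(H)}$. (2) $T^*\in \overline{\mathcal{AN}(H)}$. (3) $\sigma_{ess}(T^*T)=\sigma_{ess}(TT^* )$.
   Context: $\mathcal{B}(H)$ is the space of bounded linear operators on $H$ with the operator norm, $\mathcal{K}(H)$ the ideal of compact operators. An operator is norm attaining if its norm is attained at some unit vector of its domain. $T\in\mathcal{B}(H)$ is absolutely norm attaining (an $\mathcal{AN}$-operator) if for every nonzero closed subspace $M$ of $H$ the restriction $T|_M:M\to H$ is norm attaining. $\mathcal{AN}(H)$ is the set of such operators, and $\overline{\mathcal{AN}(H)}$ its closure in the operator norm. The essential spectrum is $\sigma_{ess}(T)=\sigma(\pi(T))$, where $\pi:\mathcal{B}(H)\to\mathcal{B}(H)/\mathcal{K}(H)$ is the quotient map. *)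

theory Defs
  imports "HOL-Analysis.Analysis" "HOL-Algebra.QuotRing"
begin

class complex_vector = real_vector +
  fixes scaleC :: "complex \<Rightarrow> 'a \<Rightarrow> 'a" (infixr \<open>*\<^sub>C\<close> 75)
  assumes scaleC_add_right: "c *\<^sub>C (x + y) = c *\<^sub>C x + c *\<^sub>C y"
    and scaleC_add_left: "(c + d) *\<^sub>C x = c *\<^sub>C x + d *\<^sub>C x"
    and scaleC_scaleC: "c *\<^sub>C d *\<^sub>C x = (c * d) *\<^sub>C x"
    and scaleC_one: "1 *\<^sub>C x = x"
    and scaleR_scaleC: "r *\<^sub>R x = complex_of_real r *\<^sub>C x"

global_interpretation complex_vector: vector_space "scaleC :: complex \<Rightarrow> 'a \<Rightarrow> 'a::complex_vector"
  by unfold_locales (simp_all add: scaleC_add_right scaleC_add_left scaleC_scaleC scaleC_one)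

text \<open>The inner product is linear in the first and conjugate linear in the second argument.
  Completeness and the metric structure come from \<^class>\<open>banach\<close>.\<close>

class complex_hilbert = complex_vector + banach +
  fixes cinner :: "'a \<Rightarrow> 'a \<Rightarrow> complex"
  assumes cinner_commute: "cinner x y = cnj (cinner y x)"
    and cinner_add_left: "cinner (x + y) z = cinner x z + cinner y z"
    and cinner_scaleC_left: "cinner (c *\<^sub>C x) y = c * cinner x y"
    and cinner_nonneg: "0 \<le> Re (cinner x x)"
    and cinner_eq_zero_iff: "cinner x x = 0 \<longleftrightarrow> x = 0"
    and norm_eq_sqrt_cinner: "norm x = sqrt (Re (cinner x x))"

definition infinite_dimensional :: "'h::complex_vector itself \<Rightarrow> bool" where
  "infinite_dimensional _ \<longleftrightarrow>
     \<not> (\<exists>B :: 'h set. finite B \<and> complex_vector.span B = UNIV)"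

text \<open>The type of bounded linear functions of the library consists of the real linear ones;
  its norm is the operator norm.\<close>

definition bounded_ops :: "('h::complex_hilbert \<Rightarrow>\<^sub>L 'h) set" where
  "bounded_ops = {T. Vector_Spaces.linear scaleC scaleC (blinfun_apply T)}"

text \<open>The adjoint exists and is unique by the Riesz representation theorem.\<close>

definition adj :: "('h::complex_hilbert \<Rightarrow>\<^sub>L 'h) \<Rightarrow> ('h \<Rightarrow>\<^sub>L 'h)" where
  "adj T = (THE S :: 'h \<Rightarrow>\<^sub>L 'h. \<forall>x y. cinner (T x) y = cinner x (S y))"

definition compact_ops :: "('h::complex_hilbert \<Rightarrow>\<^sub>L 'h) set" where
  "compact_ops = {T \<in> bounded_ops. compact (closure (blinfun_apply T ` cball 0 1))}"

definition norm_on :: "'h set \<Rightarrow> ('h::complex_hilbert \<Rightarrow>\<^sub>L 'h) \<Rightarrow> real" where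
  "norm_on M T = (SUP x\<in>{x \<in> M. norm x \<le> 1}. norm (T x))"

definition norm_attaining_on :: "'h set \<Rightarrow> ('h::complex_hilbert \<Rightarrow>\<^sub>L 'h) \<Rightarrow> bool" where
  "norm_attaining_on M T \<longleftrightarrow> (\<exists>x\<in>M. norm x = 1 \<and> norm (T x) = norm_on M T)"

definition AN_ops :: "('h::complex_hilbert \<Rightarrow>\<^sub>L 'h) set" where
  "AN_ops = {T \<in> bounded_ops. \<forall>M. complex_vector.subspace M \<and> closed M \<and> M \<noteq> {0}
     \<longrightarrow> norm_attaining_on M T}"

definition op_ring :: "('h::complex_hilbert \<Rightarrow>\<^sub>L 'h) ring" where
  "op_ring = \<lparr>carrier = bounded_ops, mult = (o\<^sub>L), one = id_blinfun, zero = 0, add = (+)\<rparr>"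

definition calkin :: "('h::complex_hilbert \<Rightarrow>\<^sub>L 'h) set ring" where
  "calkin = op_ring Quot compact_ops"

definition calkin_proj :: "('h::complex_hilbert \<Rightarrow>\<^sub>L 'h) \<Rightarrow> ('h \<Rightarrow>\<^sub>L 'h) set" where
  "calkin_proj T = compact_ops +>\<^bsub>op_ring\<^esub> T"

lift_definition scalar_op :: "complex \<Rightarrow> ('h::complex_hilbert \<Rightarrow>\<^sub>L 'h)" is "\<lambda>c x. c *\<^sub>C x"
proof -
  fix c :: complex
  have n: "norm (c *\<^sub>C x) = norm x * cmod c" for x :: 'h
  proof -
    have "cinner (c *\<^sub>C x) (c *\<^sub>C x) = (c * cnj c) * cinner x x"
      by (metis cinner_commute cinner_scaleC_left complex_cnj_mult mult.assoc)
    then have "Re (cinner (c *\<^sub>C x) (c *\<^sub>C x)) = (cmod c)\<^sup>2 * Re (cinner x x)"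
      by (simp add: complex_mult_cnj cmod_power2)
    then show ?thesis by (simp add: norm_eq_sqrt_cinner real_sqrt_mult)
  qed
  show "bounded_linear (\<lambda>x::'h. c *\<^sub>C x)"
    by (rule bounded_linear_intro[where K="cmod c"])
      (simp_all add: scaleC_add_right scaleR_scaleC scaleC_scaleC mult.commute n)
qed

text \<open>Spectrum of an element \<open>a\<close> of a unital complex algebra, given as a ring \<open>A\<close>
  together with the map \<open>\<iota>\<close> sending \<open>z\<close> to \<open>z\<close> times the unit of \<open>A\<close>.\<close>

definition spectrum :: "('a, 'm) ring_scheme \<Rightarrow> (complex \<Rightarrow> 'a) \<Rightarrow> 'a \<Rightarrow> complex set" where
  "spectrum A \<iota> a = {z. a \<ominus>\<^bsub>A\<^esub> \<iota> z \<notin> Units A}"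

definition ess_spectrum :: "('h::complex_hilbert \<Rightarrow>\<^sub>L 'h) \<Rightarrow> complex set" where
  "ess_spectrum T = spectrum calkin (\<lambda>c. calkin_proj (scalar_op c)) (calkin_proj T)"

lemma linear_scaleC_iff:
  "Vector_Spaces.linear scaleC scaleC (blinfun_apply (T :: 'h::complex_hilbert \<Rightarrow>\<^sub>L 'h))
     \<longleftrightarrow> (\<forall>c x. T (c *\<^sub>C x) = c *\<^sub>C T x)"
  by (auto simp: Vector_Spaces.linear_iff complex_vector.vector_space_axioms blinfun.add_right)

lemma ring_op_ring: "ring (op_ring :: ('h::complex_hilbert \<Rightarrow>\<^sub>L 'h) ring)"
proof (rule ringI)
  show "abelian_group (op_ring :: ('h \<Rightarrow>\<^sub>L 'h) ring)"
  proof (rule abelian_groupI)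
    fix x :: "'h \<Rightarrow>\<^sub>L 'h" assume "x \<in> carrier op_ring"
    then show "\<exists>y\<in>carrier op_ring. y \<oplus>\<^bsub>op_ring\<^esub> x = \<zero>\<^bsub>op_ring\<^esub>"
      by (intro bexI[of _ "-x"])
        (auto simp: op_ring_def bounded_ops_def linear_scaleC_iff blinfun.minus_left)
  qed (auto simp: op_ring_def bounded_ops_def linear_scaleC_iff blinfun.add_left scaleC_add_right
        add_ac blinfun.zero_left)
  show "Group.monoid (op_ring :: ('h \<Rightarrow>\<^sub>L 'h) ring)"
    by (rule monoidI)
      (auto simp: op_ring_def bounded_ops_def linear_scaleC_iff intro!: blinfun_eqI)
qed (auto simp: op_ring_def blinfun.add_left blinfun.add_right intro!: blinfun_eqI)

lemma compact_ops_subset: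
  assumes "T \<in> bounded_ops" "blinfun_apply T ` cball 0 1 \<subseteq> K" "compact K"
  shows "T \<in> compact_ops"
proof -
  have "closure (blinfun_apply T ` cball 0 1) \<subseteq> K"
    using assms by (simp add: closure_minimal compact_imp_closed)
  then have "compact (closure (blinfun_apply T ` cball 0 1))"
    using assms(3) by (metis closed_closure compact_Int_closed inf.absorb_iff2)
  then show ?thesis using assms(1) by (simp add: compact_ops_def)
qed

lemma ideal_compact_ops:
  "ideal (compact_ops :: ('h::complex_hilbert \<Rightarrow>\<^sub>L 'h) set) op_ring"
proof (rule idealI[OF ring_op_ring])
  let ?cl = "\<lambda>T :: 'h \<Rightarrow>\<^sub>L 'h. closure (blinfun_apply T ` cball 0 1)"
  have sub: "T x \<in> ?cl T" if "norm x \<le> 1" for T :: "'h \<Rightarrow>\<^sub>L 'h" and x :: 'h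
    using that by (auto intro!: subsetD[OF closure_subset])
  interpret R: ring "op_ring :: ('h \<Rightarrow>\<^sub>L 'h) ring" by (rule ring_op_ring)
  have bnd: "S \<in> carrier op_ring" if "S \<in> compact_ops" for S :: "'h \<Rightarrow>\<^sub>L 'h"
    using that by (simp add: compact_ops_def op_ring_def)
  have add: "S + T \<in> compact_ops" if "S \<in> compact_ops" "T \<in> compact_ops" for S T :: "'h \<Rightarrow>\<^sub>L 'h"
  proof (rule compact_ops_subset)
    show "S + T \<in> bounded_ops"
      using R.add.m_closed[OF bnd bnd] that by (simp add: op_ring_def)
    show "compact {x + y | x y. x \<in> ?cl S \<and> y \<in> ?cl T}"
      using that by (intro compact_sums) (simp_all add: compact_ops_def)
    show "blinfun_apply (S + T) ` cball 0 1 \<subseteq> {x + y | x y. x \<in> ?cl S \<and> y \<in> ?cl T}"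
    proof (clarsimp simp: blinfun.add_left)
      fix x :: 'h assume "norm x \<le> 1"
      then show "\<exists>u v. S x + T x = u + v \<and> u \<in> ?cl S \<and> v \<in> ?cl T"
        using sub by blast
    qed
  qed
  have comp_left: "T o\<^sub>L S \<in> compact_ops"
    if "S \<in> compact_ops" "T \<in> bounded_ops" for S T :: "'h \<Rightarrow>\<^sub>L 'h"
  proof (rule compact_ops_subset)
    show "T o\<^sub>L S \<in> bounded_ops"
      using R.m_closed[OF _ bnd, of T S] that by (simp add: op_ring_def)
    show "compact (blinfun_apply T ` ?cl S)"
      using that by (intro compact_continuous_image continuous_intros)
        (simp_all add: compact_ops_def)
    show "blinfun_apply (T o\<^sub>L S) ` cball 0 1 \<subseteq> blinfun_apply T ` ?cl S"
      using sub by auto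
  qed
  have comp_right: "S o\<^sub>L T \<in> compact_ops"
    if "S \<in> compact_ops" "T \<in> bounded_ops" for S T :: "'h \<Rightarrow>\<^sub>L 'h"
  proof (rule compact_ops_subset)
    define r where "r = norm T + 1"
    have r: "r > 0" unfolding r_def by (simp add: add_nonneg_pos)
    show "S o\<^sub>L T \<in> bounded_ops"
      using R.m_closed[OF bnd, of S T] that by (simp add: op_ring_def)
    show "compact ((\<lambda>x. r *\<^sub>R x) ` ?cl S)"
      using that by (intro compact_scaling) (simp add: compact_ops_def)
    show "blinfun_apply (S o\<^sub>L T) ` cball 0 1 \<subseteq> (\<lambda>x. r *\<^sub>R x) ` ?cl S"
    proof
      fix y assume "y \<in> blinfun_apply (S o\<^sub>L T) ` cball 0 1"
      then obtain x where x: "norm x \<le> 1" and y: "y = S (T x)" by auto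
      have "norm (T x) \<le> norm T * norm x" by (rule norm_blinfun)
      also have "\<dots> \<le> norm T * 1" using x by (intro mult_left_mono) auto
      finally have "norm (T x) \<le> r" by (simp add: r_def)
      then have "norm ((1 / r) *\<^sub>R T x) \<le> 1" using r by (simp add: divide_simps)
      from sub[OF this, of S] have "S ((1 / r) *\<^sub>R T x) \<in> ?cl S" .
      moreover have "y = r *\<^sub>R S ((1 / r) *\<^sub>R T x)"
        using r y by (simp add: blinfun.scaleR_right)
      ultimately show "y \<in> (\<lambda>x. r *\<^sub>R x) ` ?cl S" by blast
    qed
  qed
  have minus_one: "- id_blinfun \<in> (bounded_ops :: ('h \<Rightarrow>\<^sub>L 'h) set)"
    by (simp add: bounded_ops_def linear_scaleC_iff blinfun.minus_left)
  show "subgroup (compact_ops :: ('h \<Rightarrow>\<^sub>L 'h) set) (add_monoid op_ring)"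
  proof (rule R.add.subgroupI)
    show "compact_ops \<subseteq> carrier (op_ring :: ('h \<Rightarrow>\<^sub>L 'h) ring)" using bnd by blast
    have "(0 :: 'h \<Rightarrow>\<^sub>L 'h) \<in> compact_ops"
      by (rule compact_ops_subset[where K = "{0}"])
        (auto simp: bounded_ops_def linear_scaleC_iff blinfun.zero_left)
    then show "(compact_ops :: ('h \<Rightarrow>\<^sub>L 'h) set) \<noteq> {}" by blast
    show "\<ominus>\<^bsub>op_ring\<^esub> S \<in> compact_ops" if "S \<in> compact_ops" for S :: "'h \<Rightarrow>\<^sub>L 'h"
    proof -
      have m: "- S \<in> compact_ops"
        using comp_right[OF that minus_one]
        by (metis (no_types, lifting) blinfun_apply_blinfun_compose blinfun_eqI
            blinfun.minus_left blinfun.minus_right id_blinfun.rep_eq)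
      have "\<ominus>\<^bsub>op_ring\<^esub> S = - S"
        using bnd[OF m] bnd[OF that] by (intro R.minus_equality) (simp_all add: op_ring_def)
      with m show ?thesis by simp
    qed
    show "S \<oplus>\<^bsub>op_ring\<^esub> T \<in> compact_ops"
      if "S \<in> compact_ops" "T \<in> compact_ops" for S T :: "'h \<Rightarrow>\<^sub>L 'h"
      using add[OF that] by (simp add: op_ring_def)
  qed
  fix S T :: "'h \<Rightarrow>\<^sub>L 'h"
  assume "S \<in> compact_ops" "T \<in> carrier op_ring"
  then show "T \<otimes>\<^bsub>op_ring\<^esub> S \<in> compact_ops" "S \<otimes>\<^bsub>op_ring\<^esub> T \<in> compact_ops"
    using comp_left comp_right by (simp_all add: op_ring_def)
qed

lemma ring_calkin: "ring (calkin :: ('h::complex_hilbert \<Rightarrow>\<^sub>L 'h) set ring)"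
  unfolding calkin_def by (rule ideal.quotient_is_ring[OF ideal_compact_ops])

end

theory Submission
  imports Defs
begin


text \<open>
  An operator \<open>T\<close> lies in the closure of the \<open>AN\<close>-operators iff \<open>T\<^sup>* T - \<alpha>\<close> is compact for some
  real \<open>\<alpha>\<close>; given this, the theorem is algebra in the Calkin ring.

  If \<open>T\<^sup>* T - \<alpha>\<close> is compact and \<open>\<alpha> > 0\<close>, then \<open>T\<^sup>* T = \<alpha> (1 + E) + F\<close> with \<open>E\<close> small and \<open>F\<close> compact and
  vanishing on a subspace of finite codimension. With a symmetric \<open>R\<close> near the identity such that
  \<open>R (1 + E) R = 1\<close>, the operator \<open>T R\<close> is near \<open>T\<close> and \<open>(T R)\<^sup>* T R = \<alpha> + R F R\<close>, which makes it
  absolutely norm attaining. If \<open>\<alpha> \<le> 0\<close>, then \<open>T\<close> itself is absolutely norm attaining.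

  Conversely, suppose that the values \<open>\<parallel>T x\<parallel>\<^sup>2\<close> for unit vectors \<open>x\<close> do not concentrate at a single number
  on subspaces of finite codimension. Then all values of an interval are taken on each such subspace. So
  there is a sequence of unit vectors that is orthogonal for the forms \<open>\<langle>x, y\<rangle>\<close> and \<open>\<langle>T x, T y\<rangle>\<close> and along
  which \<open>\<parallel>T x\<parallel>\<^sup>2\<close> converges to its supremum from strictly below, and \<open>T\<close> does not attain its norm on the closed
  span. Concentration survives norm limits and makes \<open>T\<^sup>* T - \<alpha>\<close> compact.
\<close>

section \<open>Complex Hilbert spaces\<close>

lemma cinner_add_right: "cinner (x::'h::complex_hilbert) (y + z) = cinner x y + cinner x z"
  by (metis cinner_commute cinner_add_left complex_cnj_add)

lemma cinner_scaleC_right: "cinner (x::'h::complex_hilbert) (c *\<^sub>C y) = cnj c * cinner x y"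
  by (metis cinner_commute cinner_scaleC_left complex_cnj_mult)

lemma cinner_scaleR_left: "cinner (r *\<^sub>R (x::'h::complex_hilbert)) y = r *\<^sub>R cinner x y"
  by (simp add: scaleR_scaleC cinner_scaleC_left scaleR_conv_of_real)

lemma cinner_scaleR_right: "cinner (x::'h::complex_hilbert) (r *\<^sub>R y) = r *\<^sub>R cinner x y"
  by (simp add: scaleR_scaleC cinner_scaleC_right scaleR_conv_of_real)

lemma cinner_minus_left: "cinner (- (x::'h::complex_hilbert)) y = - cinner x y"
  using cinner_scaleR_left[of "-1" x y] by simp

lemma cinner_minus_right: "cinner (x::'h::complex_hilbert) (- y) = - cinner x y"
  using cinner_scaleR_right[of x "-1" y] by simp

lemma cinner_diff_left: "cinner (x - (y::'h::complex_hilbert)) z = cinner x z - cinner y z"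
  using cinner_add_left[of x "-y" z] by (simp add: cinner_minus_left)

lemma cinner_diff_right: "cinner (x::'h::complex_hilbert) (y - z) = cinner x y - cinner x z"
  using cinner_add_right[of x y "-z"] by (simp add: cinner_minus_right)

lemma cinner_zero_left [simp]: "cinner 0 (x::'h::complex_hilbert) = 0"
  using cinner_scaleR_left[of 0 0 x] by simp

lemma cinner_zero_right [simp]: "cinner (x::'h::complex_hilbert) 0 = 0"
  using cinner_scaleR_right[of x 0 0] by simp

lemmas cinner_simps = cinner_add_left cinner_add_right cinner_diff_left cinner_diff_right
  cinner_scaleC_left cinner_scaleC_right cinner_scaleR_left cinner_scaleR_right
  cinner_minus_left cinner_minus_right

lemma Re_cinner_commute: "Re (cinner (x::'h::complex_hilbert) y) = Re (cinner y x)"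
  by (metis cinner_commute cnj.sel(1))

lemma cinner_eq_zero_commute: "cinner (x::'h::complex_hilbert) y = 0 \<longleftrightarrow> cinner y x = 0"
  by (metis cinner_commute complex_cnj_zero)

lemma Re_cinner_self: "Re (cinner (x::'h::complex_hilbert) x) = (norm x)\<^sup>2"
  by (simp add: norm_eq_sqrt_cinner cinner_nonneg)

lemma cinner_self: "cinner (x::'h::complex_hilbert) x = of_real ((norm x)\<^sup>2)"
proof -
  have "Im (cinner x x) = - Im (cinner x x)"
    by (metis cinner_commute cnj.sel(2))
  then show ?thesis by (simp add: complex_eq_iff Re_cinner_self)
qed

lemma norm_scaleC: "norm (c *\<^sub>C (x::'h::complex_hilbert)) = cmod c * norm x"
proof -
  have "(norm (c *\<^sub>C x))\<^sup>2 = Re ((c * cnj c) * cinner x x)"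
    by (simp add: Re_cinner_self[symmetric] cinner_simps algebra_simps)
  also have "\<dots> = (cmod c * norm x)\<^sup>2"
    by (simp add: complex_mult_cnj cinner_self cmod_power2 power_mult_distrib)
  finally show ?thesis by (simp add: power2_eq_iff_nonneg)
qed

lemma power2_norm_add:
  "(norm (x + (y::'h::complex_hilbert)))\<^sup>2 = (norm x)\<^sup>2 + 2 * Re (cinner x y) + (norm y)\<^sup>2"
  using Re_cinner_commute[of x y] by (simp add: Re_cinner_self[symmetric] cinner_simps)

lemma power2_norm_diff:
  "(norm (x - (y::'h::complex_hilbert)))\<^sup>2 = (norm x)\<^sup>2 - 2 * Re (cinner x y) + (norm y)\<^sup>2"
  using Re_cinner_commute[of x y] by (simp add: Re_cinner_self[symmetric] cinner_simps)

lemma norm_parallelogram: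
  "(norm (x + (y::'h::complex_hilbert)))\<^sup>2 + (norm (x - y))\<^sup>2 = 2 * (norm x)\<^sup>2 + 2 * (norm y)\<^sup>2"
  by (simp add: power2_norm_add power2_norm_diff)

text \<open>Pythagoras: the vector subtracted is the component of \<open>x\<close> along
  \<open>y\<close>. Nonnegativity of the left side gives the Cauchy-Schwarz inequality, and
  minimality of a nearest point gives orthogonality.\<close>

lemma power2_norm_diff_component:
  fixes x y :: "'h::complex_hilbert"
  assumes "y \<noteq> 0"
  shows "(norm (x - (cinner x y / of_real ((norm y)\<^sup>2)) *\<^sub>C y))\<^sup>2
    = (norm x)\<^sup>2 - (cmod (cinner x y))\<^sup>2 / (norm y)\<^sup>2"
proof -
  define c where "c = cinner x y / of_real ((norm y)\<^sup>2)"
  have "cnj c * cinner x y = of_real ((cmod (cinner x y))\<^sup>2 / (norm y)\<^sup>2)"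
    by (simp add: c_def complex_norm_square[symmetric] mult.commute flip: of_real_power)
  moreover have "cmod c * norm y = cmod (cinner x y) / norm y"
    using assms by (simp add: c_def norm_divide norm_mult power2_eq_square)
  moreover have "(norm (x - c *\<^sub>C y))\<^sup>2
      = (norm x)\<^sup>2 - 2 * Re (cnj c * cinner x y) + (cmod c * norm y)\<^sup>2"
    by (simp add: power2_norm_diff cinner_scaleC_right norm_scaleC)
  ultimately show ?thesis unfolding c_def[symmetric]
    by (simp only: Re_complex_of_real) (simp add: power_divide)
qed

lemma norm_cinner_le: "cmod (cinner (x::'h::complex_hilbert) y) \<le> norm x * norm y"
proof (cases "y = 0")
  case False
  then have "(norm x)\<^sup>2 - (cmod (cinner x y))\<^sup>2 / (norm y)\<^sup>2 \<ge> 0"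
    by (metis power2_norm_diff_component zero_le_power2)
  then have "(cmod (cinner x y))\<^sup>2 \<le> (norm x * norm y)\<^sup>2"
    using False by (simp add: divide_simps power_mult_distrib)
  then show ?thesis by (rule power2_le_imp_le) simp
qed simp

lemma bounded_bilinear_cinner:
  "bounded_bilinear (cinner :: 'h::complex_hilbert \<Rightarrow> 'h \<Rightarrow> complex)"
  by unfold_locales
    (auto simp: cinner_simps intro!: exI[of _ 1] norm_cinner_le)

lemmas continuous_on_cinner [continuous_intros] =
  bounded_bilinear.continuous_on[OF bounded_bilinear_cinner]

lemma Re_cinner_le: "Re (cinner (x::'h::complex_hilbert) y) \<le> norm x * norm y"
  using norm_cinner_le[of x y] complex_Re_le_cmod[of "cinner x y"] by linarith

lemma csubspace_iff: "complex_vector.subspace M \<longleftrightarrow>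
    0 \<in> M \<and> (\<forall>x\<in>M. \<forall>y\<in>M. x + y \<in> M) \<and> (\<forall>c. \<forall>x\<in>M. c *\<^sub>C x \<in> M)"
  by (rule complex_vector.subspace_def)

lemma csubspace_scaleR:
  assumes "complex_vector.subspace M" "x \<in> M" shows "r *\<^sub>R x \<in> M"
  using assms by (simp add: scaleR_scaleC complex_vector.subspace_scale)

lemma cinner_ext: "(\<And>z. cinner z x = cinner z y) \<Longrightarrow> x = (y::'h::complex_hilbert)"
  by (metis cinner_diff_right cinner_eq_zero_iff eq_iff_diff_eq_0)

text \<open>A minimising sequence for the distance from \<open>x\<close> to \<open>M\<close> is Cauchy by the parallelogram law.\<close>

lemma exists_nearest_point:
  fixes M :: "'h::complex_hilbert set"
  assumes M: "complex_vector.subspace M" "closed M"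
  shows "\<exists>m\<in>M. \<forall>y\<in>M. norm (x - m) \<le> norm (x - y)"
proof -
  define d where "d = (INF y\<in>M. norm (x - y))"
  have ne: "M \<noteq> {}" using M by (auto simp: csubspace_iff)
  have bdd: "bdd_below ((\<lambda>y. norm (x - y)) ` M)" by (rule bdd_belowI[of _ 0]) auto
  have dle: "d \<le> norm (x - y)" if "y \<in> M" for y
    unfolding d_def by (rule cINF_lower[OF bdd that])
  have d0: "d \<ge> 0" unfolding d_def by (rule cINF_greatest[OF ne]) simp
  have "\<exists>y\<in>M. norm (x - y) < d + 1 / Suc n" for n
    using cINF_less_iff[OF ne bdd, of "d + 1 / Suc n"] by (simp add: d_def)
  then obtain m where mM: "\<And>n. m n \<in> M" and md: "\<And>n. norm (x - m n) < d + 1 / Suc n"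
    by metis
  have lim: "(\<lambda>n. norm (x - m n)) \<longlonglongrightarrow> d"
  proof (rule tendsto_sandwich[of "\<lambda>_. d" _ _ "\<lambda>n. d + 1 / Suc n"])
    show "(\<lambda>n. d + 1 / Suc n) \<longlonglongrightarrow> d"
      using tendsto_add[OF tendsto_const[of d] LIMSEQ_inverse_real_of_nat] by (simp add: divide_inverse)
  qed (auto intro!: eventuallyI dle[OF mM] less_imp_le[OF md] simp del: of_nat_Suc)
  \<comment> \<open>Parallelogram law for \<open>x - m i\<close> and \<open>x - m j\<close>: their
    sum is twice the vector from the midpoint, a point of \<open>M\<close>, to \<open>x\<close>,
    hence of norm at least \<open>2 * d\<close>.\<close>
  have est: "(norm (m i - m j))\<^sup>2 \<le> 2 * (norm (x - m i))\<^sup>2 + 2 * (norm (x - m j))\<^sup>2 - 4 * d\<^sup>2" for i j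
  proof -
    have "(1/2) *\<^sub>R (m i + m j) \<in> M"
      using M(1) mM by (intro csubspace_scaleR complex_vector.subspace_add) auto
    then have "d \<le> norm (x - (1/2) *\<^sub>R (m i + m j))" by (rule dle)
    then have "2 * d \<le> norm (2 *\<^sub>R (x - (1/2) *\<^sub>R (m i + m j)))" by simp
    also have "2 *\<^sub>R (x - (1/2) *\<^sub>R (m i + m j)) = (x - m i) + (x - m j)"
      by (simp add: algebra_simps scaleR_2)
    finally have "(2 * d)\<^sup>2 \<le> (norm ((x - m i) + (x - m j)))\<^sup>2" using d0 by (intro power_mono) auto
    moreover have "norm ((x - m i) - (x - m j)) = norm (m i - m j)" by (simp add: norm_minus_commute)
    ultimately show ?thesis
      using norm_parallelogram[of "x - m i" "x - m j"] by simp
  qed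
  have "Cauchy m"
  proof (rule metric_CauchyI)
    fix e :: real assume e: "e > 0"
    have "(\<lambda>n. (norm (x - m n))\<^sup>2) \<longlonglongrightarrow> d\<^sup>2" by (intro tendsto_intros lim)
    then have "eventually (\<lambda>n. (norm (x - m n))\<^sup>2 < d\<^sup>2 + e\<^sup>2 / 4) sequentially"
      using e by (intro order_tendstoD(2)) auto
    then obtain N where N: "\<And>n. n \<ge> N \<Longrightarrow> (norm (x - m n))\<^sup>2 < d\<^sup>2 + e\<^sup>2 / 4"
      by (auto simp: eventually_sequentially)
    have "dist (m i) (m j) < e" if "i \<ge> N" "j \<ge> N" for i j
    proof -
      have "(norm (m i - m j))\<^sup>2 < e\<^sup>2" using est[of i j] N[OF that(1)] N[OF that(2)] by linarith
      then show ?thesis using e by (simp add: dist_norm power_less_imp_less_base)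
    qed
    then show "\<exists>N. \<forall>i\<ge>N. \<forall>j\<ge>N. dist (m i) (m j) < e" by blast
  qed
  then obtain l where l: "m \<longlonglongrightarrow> l" by (auto simp: convergent_eq_Cauchy[symmetric])
  have "l \<in> M" using closed_sequentially[OF M(2) _ l] mM by blast
  moreover have "(\<lambda>n. norm (x - m n)) \<longlonglongrightarrow> norm (x - l)" by (intro tendsto_intros l)
  then have "norm (x - l) = d" using lim LIMSEQ_unique by blast
  ultimately show ?thesis using dle by auto
qed

text \<open>The nearest point \<open>m\<close> works: subtracting from \<open>x - m\<close> its
  component along some \<open>y\<close> in \<open>M\<close> only moves \<open>m\<close> within
  \<open>M\<close>, and would shorten the vector unless that component is 0.\<close>

lemma exists_orthogonal_projection:
  fixes M :: "'h::complex_hilbert set"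
  assumes M: "complex_vector.subspace M" "closed M"
  shows "\<exists>m\<in>M. \<forall>y\<in>M. cinner (x - m) y = 0"
proof -
  obtain m where m: "m \<in> M" and near: "\<And>y. y \<in> M \<Longrightarrow> norm (x - m) \<le> norm (x - y)"
    using exists_nearest_point[OF M] by blast
  have "cinner (x - m) y = 0" if y: "y \<in> M" for y
  proof (cases "y = 0")
    case False
    define c where "c = cinner (x - m) y / of_real ((norm y)\<^sup>2)"
    have "m + c *\<^sub>C y \<in> M"
      using M(1) m y by (intro complex_vector.subspace_add complex_vector.subspace_scale)
    from near[OF this] have "(norm (x - m))\<^sup>2 \<le> (norm ((x - m) - c *\<^sub>C y))\<^sup>2"
      by (intro power_mono) (auto simp: algebra_simps)
    also have "\<dots> = (norm (x - m))\<^sup>2 - (cmod (cinner (x - m) y))\<^sup>2 / (norm y)\<^sup>2"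
      unfolding c_def by (rule power2_norm_diff_component[OF False])
    finally have "(cmod (cinner (x - m) y))\<^sup>2 / (norm y)\<^sup>2 \<le> 0" by linarith
    then show ?thesis using False by (simp add: divide_simps split: if_splits)
  qed simp
  then show ?thesis using m by blast
qed

text \<open>Unless \<open>f\<close> vanishes, there is a vector \<open>u\<close> outside its kernel
  and orthogonal to it. Every \<open>z\<close> is a multiple of \<open>u\<close> modulo the kernel,
  so \<open>f\<close> is a multiple of the inner product with \<open>u\<close>.\<close>

lemma riesz_representation:
  fixes f :: "'h::complex_hilbert \<Rightarrow> complex"
  assumes f: "bounded_linear f" and fC: "\<And>c x. f (c *\<^sub>C x) = c * f x"
  shows "\<exists>y. \<forall>x. f x = cinner x y"
proof (cases "\<forall>x. f x = 0")
  case True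
  then show ?thesis by (intro exI[of _ 0]) simp
next
  case False
  then obtain x where x: "f x \<noteq> 0" by blast
  interpret f: bounded_linear f by (rule f)
  define M where "M = {x. f x = 0}"
  have "closed M" unfolding M_def
    by (intro closed_Collect_eq continuous_intros f.continuous_on)
  moreover have "complex_vector.subspace M" by (auto simp: M_def csubspace_iff f.add fC f.zero)
  ultimately obtain m where m: "m \<in> M" and orth: "\<And>y. y \<in> M \<Longrightarrow> cinner (x - m) y = 0"
    using exists_orthogonal_projection by blast
  define u where "u = x - m"
  have fu: "f u \<noteq> 0" using x m by (simp add: u_def M_def f.diff)
  then have u: "u \<noteq> 0" by auto
  \<comment> \<open>Scaled so that \<open>cinner u y = f u\<close>.\<close>
  define y where "y = (cnj (f u) / of_real ((norm u)\<^sup>2)) *\<^sub>C u"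
  have "f z = cinner z y" for z
  proof -
    have "z - (f z / f u) *\<^sub>C u \<in> M" using fu by (simp add: M_def f.diff fC)
    then have "cinner u (z - (f z / f u) *\<^sub>C u) = 0" unfolding u_def by (rule orth)
    then have "cinner (z - (f z / f u) *\<^sub>C u) u = 0" by (simp add: cinner_eq_zero_commute)
    then have "cinner z u = (f z / f u) * of_real ((norm u)\<^sup>2)"
      by (simp add: cinner_simps cinner_self)
    then show ?thesis using fu u by (simp add: y_def cinner_scaleC_right)
  qed
  then show ?thesis by blast
qed

section \<open>Bounded operators and adjoints\<close>

lemma bounded_ops_iff:
  "T \<in> bounded_ops \<longleftrightarrow> (\<forall>c x. blinfun_apply T (c *\<^sub>C x) = c *\<^sub>C T x)"
  by (simp add: bounded_ops_def linear_scaleC_iff)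

lemma bounded_ops_scaleC: "T \<in> bounded_ops \<Longrightarrow> blinfun_apply T (c *\<^sub>C x) = c *\<^sub>C T x"
  by (simp add: bounded_ops_iff)

lemma bounded_ops_closed [simp]:
  fixes S T :: "'h::complex_hilbert \<Rightarrow>\<^sub>L 'h"
  shows "id_blinfun \<in> (bounded_ops :: ('h \<Rightarrow>\<^sub>L 'h) set)" "0 \<in> (bounded_ops :: ('h \<Rightarrow>\<^sub>L 'h) set)"
    "S \<in> bounded_ops \<Longrightarrow> T \<in> bounded_ops \<Longrightarrow> S + T \<in> bounded_ops"
    "S \<in> bounded_ops \<Longrightarrow> T \<in> bounded_ops \<Longrightarrow> S - T \<in> bounded_ops"
    "T \<in> bounded_ops \<Longrightarrow> - T \<in> bounded_ops"
    "T \<in> bounded_ops \<Longrightarrow> r *\<^sub>R T \<in> bounded_ops"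
    "S \<in> bounded_ops \<Longrightarrow> T \<in> bounded_ops \<Longrightarrow> S o\<^sub>L T \<in> bounded_ops"
  by (auto simp: bounded_ops_iff blinfun.bilinear_simps scaleC_add_right scaleR_scaleC scaleC_scaleC
      complex_vector.scale_right_diff_distrib mult.commute)

lemma exists_bounded_op:
  fixes f :: "'h::complex_hilbert \<Rightarrow> 'h"
  assumes "\<And>x y. f (x + y) = f x + f y" "\<And>c x. f (c *\<^sub>C x) = c *\<^sub>C f x"
    "\<And>x. norm (f x) \<le> b * norm x"
  shows "\<exists>T\<in>bounded_ops. \<forall>x. blinfun_apply T x = f x"
proof (intro bexI allI)
  have "bounded_linear f"
    using assms by (intro bounded_linear_intro[where K = b]) (auto simp: scaleR_scaleC mult.commute)
  then show *: "blinfun_apply (Blinfun f) x = f x" for x by (simp add: bounded_linear_Blinfun_apply)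
  show "Blinfun f \<in> bounded_ops" by (simp add: bounded_ops_iff * assms(2))
qed

lemma exists_adjoint:
  fixes T :: "'h::complex_hilbert \<Rightarrow>\<^sub>L 'h"
  assumes T: "T \<in> bounded_ops"
  shows "\<exists>S\<in>bounded_ops. norm S \<le> norm T \<and> (\<forall>x y. cinner (T x) y = cinner x (blinfun_apply S y))"
proof -
  have "\<exists>z. \<forall>x. cinner (T x) y = cinner x z" for y
  proof (rule riesz_representation)
    show "bounded_linear (\<lambda>x. cinner (T x) y)"
      by (rule bounded_linear_compose[OF bounded_bilinear.bounded_linear_left[OF bounded_bilinear_cinner]
          blinfun.bounded_linear_right])
  qed (simp add: bounded_ops_scaleC[OF T] cinner_simps)
  then obtain s where s: "\<And>x y. cinner (T x) y = cinner x (s y)" by metis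
  have bnd: "norm (s y) \<le> norm T * norm y" for y
  proof -
    have "(norm (s y))\<^sup>2 = Re (cinner (T (s y)) y)" by (simp add: s Re_cinner_self)
    also have "\<dots> \<le> norm (T (s y)) * norm y" by (rule Re_cinner_le)
    also have "\<dots> \<le> norm T * norm (s y) * norm y" by (intro mult_right_mono norm_blinfun) auto
    finally show ?thesis by (cases "s y = 0") (auto simp: power2_eq_square mult_ac)
  qed
  have "\<exists>S\<in>bounded_ops. \<forall>y. blinfun_apply S y = s y"
  proof (rule exists_bounded_op)
    show "s (x + y) = s x + s y" for x y
      by (rule cinner_ext) (simp add: s[symmetric] cinner_add_right)
    show "s (c *\<^sub>C x) = c *\<^sub>C s x" for c x
      by (rule cinner_ext) (simp add: s[symmetric] cinner_scaleC_right)
  qed (rule bnd)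
  then obtain S where S: "S \<in> bounded_ops" "\<And>y. blinfun_apply S y = s y" by blast
  show ?thesis
  proof (intro bexI conjI)
    show "norm S \<le> norm T" by (rule norm_blinfun_bound) (auto simp: S bnd)
  qed (auto simp: S s)
qed

lemma adj_unique:
  assumes "\<And>x y. cinner (blinfun_apply T x) y = cinner x (blinfun_apply S y)"
  shows "adj T = S"
  unfolding adj_def
proof (rule the_equality)
  fix S' :: "'a \<Rightarrow>\<^sub>L 'a" assume "\<forall>x y. cinner (T x) y = cinner x (S' y)"
  then show "S' = S" using assms by (intro blinfun_eqI cinner_ext) metis
qed (simp add: assms)

lemma
  assumes "T \<in> bounded_ops"
  shows cinner_adj_right: "cinner x (blinfun_apply (adj T) y) = cinner (T x) y"
    and adj_in_bounded_ops [simp]: "adj T \<in> bounded_ops"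
    and norm_adj_le: "norm (adj T) \<le> norm T"
  using exists_adjoint[OF assms] adj_unique[of T] by metis+

lemma cinner_adj_left:
  "T \<in> bounded_ops \<Longrightarrow> cinner (blinfun_apply (adj T) x) y = cinner x (T y)"
  by (metis cinner_adj_right cinner_commute)

lemma adj_adj: "T \<in> bounded_ops \<Longrightarrow> adj (adj T) = T"
  by (rule adj_unique) (rule cinner_adj_left)

lemma adj_compose:
  assumes "S \<in> bounded_ops" "T \<in> bounded_ops"
  shows "adj (S o\<^sub>L T) = adj T o\<^sub>L adj S"
  using assms by (intro adj_unique) (simp add: cinner_adj_right)

lemma adj_compose_self: "T \<in> bounded_ops \<Longrightarrow> adj (adj T o\<^sub>L T) = adj T o\<^sub>L T"
  by (simp add: adj_compose adj_adj)

lemma adj_add: "S \<in> bounded_ops \<Longrightarrow> T \<in> bounded_ops \<Longrightarrow> adj (S + T) = adj S + adj T"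
  by (intro adj_unique) (simp add: blinfun.bilinear_simps cinner_simps cinner_adj_right)

lemma adj_scaleR: "T \<in> bounded_ops \<Longrightarrow> adj (r *\<^sub>R T) = r *\<^sub>R adj T"
  by (intro adj_unique) (simp add: blinfun.bilinear_simps cinner_simps cinner_adj_right)

lemma adj_diff: "S \<in> bounded_ops \<Longrightarrow> T \<in> bounded_ops \<Longrightarrow> adj (S - T) = adj S - adj T"
  by (intro adj_unique) (simp add: blinfun.bilinear_simps cinner_simps cinner_adj_right)

lemma adj_id [simp]: "adj (id_blinfun :: 'h::complex_hilbert \<Rightarrow>\<^sub>L 'h) = id_blinfun"
  by (rule adj_unique) simp

lemmas blinfun_compose_simps =
  bounded_bilinear.add_left[OF bounded_bilinear_blinfun_compose]
  bounded_bilinear.add_right[OF bounded_bilinear_blinfun_compose]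
  bounded_bilinear.diff_left[OF bounded_bilinear_blinfun_compose]
  bounded_bilinear.diff_right[OF bounded_bilinear_blinfun_compose]
  bounded_bilinear.minus_left[OF bounded_bilinear_blinfun_compose]
  bounded_bilinear.minus_right[OF bounded_bilinear_blinfun_compose]
  bounded_bilinear.scaleR_left[OF bounded_bilinear_blinfun_compose]
  bounded_bilinear.scaleR_right[OF bounded_bilinear_blinfun_compose]

section \<open>Projection operators and orthogonal complements\<close>

lemma exists_projection_operator:
  fixes M :: "'h::complex_hilbert set"
  assumes M: "complex_vector.subspace M" "closed M"
  obtains P where "P \<in> bounded_ops" "adj P = P" "norm P \<le> 1" "\<And>x. blinfun_apply P x \<in> M"
    "\<And>x y. y \<in> M \<Longrightarrow> cinner (x - blinfun_apply P x) y = 0"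
proof -
  obtain p where pM: "\<And>x. p x \<in> M" and orth: "\<And>x y. y \<in> M \<Longrightarrow> cinner (x - p x) y = 0"
    using exists_orthogonal_projection[OF M] by metis
  \<comment> \<open>Membership and orthogonality determine the projection, as two candidates differ
    by a vector of \<open>M\<close> orthogonal to \<open>M\<close>. Linearity of \<open>p\<close>
    then only requires verifying a candidate.\<close>
  have uniq: "p x = m" if "m \<in> M" "\<And>y. y \<in> M \<Longrightarrow> cinner (x - m) y = 0" for x m
  proof -
    have d: "p x - m \<in> M" using pM that(1) M(1) by (simp add: complex_vector.subspace_diff)
    have "cinner (p x - m) (p x - m) = cinner (x - m) (p x - m) - cinner (x - p x) (p x - m)"
      by (simp add: cinner_diff_left)
    also have "\<dots> = 0" using d that(2) orth by simp
    finally show ?thesis by (simp add: cinner_eq_zero_iff)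
  qed
  have pp: "cinner (p x) y = cinner x (p y)" for x y
  proof -
    have "cinner (x - p x) (p y) = 0" "cinner (y - p y) (p x) = 0" using orth pM by auto
    then have "cinner (x - p x) (p y) = 0" "cinner (p x) (y - p y) = 0"
      by (auto simp: cinner_eq_zero_commute)
    then show ?thesis by (simp add: cinner_diff_left cinner_diff_right)
  qed
  have nrm: "norm (p x) \<le> 1 * norm x" for x
  proof -
    have "cinner (x - p x) (p x) = 0" using orth pM by auto
    then have "(norm x)\<^sup>2 = (norm (x - p x))\<^sup>2 + (norm (p x))\<^sup>2"
      using power2_norm_add[of "x - p x" "p x"] by simp
    then have "(norm (p x))\<^sup>2 \<le> (norm x)\<^sup>2" by simp
    then show ?thesis by simp
  qed
  have "\<exists>P\<in>bounded_ops. \<forall>x. blinfun_apply P x = p x"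
  proof (rule exists_bounded_op)
    fix x y :: 'h and c
    show "p (x + y) = p x + p y"
    proof (rule uniq)
      show "p x + p y \<in> M" using pM M(1) by (simp add: complex_vector.subspace_add)
      fix z assume "z \<in> M"
      then show "cinner (x + y - (p x + p y)) z = 0"
        using orth[of z x] orth[of z y] by (simp add: cinner_simps)
    qed
    show "p (c *\<^sub>C x) = c *\<^sub>C p x"
    proof (rule uniq)
      show "c *\<^sub>C p x \<in> M" using pM M(1) by (simp add: complex_vector.subspace_scale)
      fix z assume "z \<in> M"
      then show "cinner (c *\<^sub>C x - c *\<^sub>C p x) z = 0"
        using orth[of z x] by (simp add: cinner_simps)
    qed
  qed (rule nrm)
  then obtain P where P: "P \<in> bounded_ops" "\<And>x. blinfun_apply P x = p x" by blast
  show ?thesis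
  proof (rule that[of P])
    show "adj P = P" by (rule adj_unique) (simp add: P pp)
    show "norm P \<le> 1" by (rule norm_blinfun_bound) (use nrm in \<open>auto simp: P\<close>)
  qed (auto simp: P pM orth)
qed

definition orth_compl :: "'h::complex_hilbert set \<Rightarrow> 'h set" where
  "orth_compl Y = {x. \<forall>y\<in>Y. cinner x y = 0}"

lemma csubspace_orth_compl: "complex_vector.subspace (orth_compl Y)"
  by (auto simp: orth_compl_def csubspace_iff cinner_simps)

lemma closed_orth_compl: "closed (orth_compl Y)"
proof -
  have "orth_compl Y = (\<Inter>y\<in>Y. {x. cinner x y = 0})" by (auto simp: orth_compl_def)
  then show ?thesis by (auto intro!: closed_Collect_eq continuous_intros)
qed

lemma orth_compl_Un: "orth_compl (Y \<union> Z) = orth_compl Y \<inter> orth_compl Z"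
  by (auto simp: orth_compl_def)


section \<open>Compact operators\<close>

lemma compact_ops_imp_bounded: "K \<in> compact_ops \<Longrightarrow> K \<in> bounded_ops"
  by (simp add: compact_ops_def)

lemma compact_ops_compose_left:
  "K \<in> compact_ops \<Longrightarrow> T \<in> bounded_ops \<Longrightarrow> T o\<^sub>L K \<in> compact_ops"
  using ideal.I_l_closed[OF ideal_compact_ops, of K T] by (simp add: op_ring_def)

lemma compact_ops_compose_right:
  "K \<in> compact_ops \<Longrightarrow> T \<in> bounded_ops \<Longrightarrow> K o\<^sub>L T \<in> compact_ops"
  using ideal.I_r_closed[OF ideal_compact_ops, of K T] by (simp add: op_ring_def)

lemma compact_ops_add:
  "K \<in> compact_ops \<Longrightarrow> L \<in> compact_ops \<Longrightarrow> K + L \<in> compact_ops"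
  using additive_subgroup.a_closed[OF ideal.axioms(1)[OF ideal_compact_ops], of K L]
  by (simp add: op_ring_def)

lemma compact_ops_zero: "0 \<in> compact_ops"
  using additive_subgroup.zero_closed[OF ideal.axioms(1)[OF ideal_compact_ops]]
  by (simp add: op_ring_def)

lemma compact_ops_scaleR:
  assumes "K \<in> compact_ops" shows "r *\<^sub>R K \<in> compact_ops"
proof -
  have "(r *\<^sub>R id_blinfun) o\<^sub>L K \<in> compact_ops"
    using assms by (intro compact_ops_compose_left) simp_all
  moreover have "(r *\<^sub>R id_blinfun) o\<^sub>L K = r *\<^sub>R K"
    by (rule blinfun_eqI) (simp add: blinfun.bilinear_simps)
  ultimately show ?thesis by simp
qed

lemma compact_ops_diff:
  "K \<in> compact_ops \<Longrightarrow> L \<in> compact_ops \<Longrightarrow> K - L \<in> compact_ops"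
  using compact_ops_add[of K "(-1) *\<^sub>R L"] compact_ops_scaleR[of L "-1"] by simp

text \<open>The space is complete, so total boundedness of the image itself suffices. Finite nets
  are easier to carry from one operator to another than compactness of a closure.\<close>

lemma compact_ops_iff_totally_bounded:
  "T \<in> compact_ops \<longleftrightarrow> T \<in> bounded_ops \<and>
    (\<forall>e>0. \<exists>F. finite F \<and> blinfun_apply T ` cball 0 1 \<subseteq> (\<Union>y\<in>F. ball y e))"
proof safe
  assume T: "T \<in> compact_ops"
  then show "T \<in> bounded_ops" by (rule compact_ops_imp_bounded)
  fix e :: real assume "e > 0"
  then obtain F where F: "finite F" "closure (blinfun_apply T ` cball 0 1) \<subseteq> (\<Union>y\<in>F. ball y e)"
    using T unfolding compact_ops_def compact_eq_totally_bounded by blast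
  show "\<exists>F. finite F \<and> blinfun_apply T ` cball 0 1 \<subseteq> (\<Union>y\<in>F. ball y e)"
    using F(1) order_trans[OF closure_subset F(2)] by blast
next
  assume T: "T \<in> bounded_ops"
    and tb: "\<forall>e>0. \<exists>F. finite F \<and> blinfun_apply T ` cball 0 1 \<subseteq> (\<Union>y\<in>F. ball y e)"
  have "\<exists>F. finite F \<and> closure (blinfun_apply T ` cball 0 1) \<subseteq> (\<Union>y\<in>F. ball y e)"
    if e: "e > 0" for e
  proof -
    \<comment> \<open>Half the radius: the closed balls of radius \<open>e/2\<close> have a closed
      union, which contains the closure of the image and still fits into the open balls of radius
      \<open>e\<close>.\<close>
    obtain F where F: "finite F" "blinfun_apply T ` cball 0 1 \<subseteq> (\<Union>y\<in>F. ball y (e/2))"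
      using tb[rule_format, of "e/2"] e by auto
    have "blinfun_apply T ` cball 0 1 \<subseteq> (\<Union>y\<in>F. cball y (e/2))"
      by (rule order_trans[OF F(2)]) (intro UN_mono ball_subset_cball subset_refl)
    then have "closure (blinfun_apply T ` cball 0 1) \<subseteq> (\<Union>y\<in>F. cball y (e/2))"
      using F(1) by (intro closure_minimal) auto
    also have "\<dots> \<subseteq> (\<Union>y\<in>F. ball y e)" using e by (intro UN_mono) auto
    finally show ?thesis using F(1) by blast
  qed
  then have "compact (closure (blinfun_apply T ` cball 0 1))"
    unfolding compact_eq_totally_bounded by (simp add: complete_eq_closed)
  then show "T \<in> compact_ops" using T by (simp add: compact_ops_def)
qed

lemma closed_bounded_ops: "closed (bounded_ops :: ('h::complex_hilbert \<Rightarrow>\<^sub>L 'h) set)"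
proof -
  \<comment> \<open>Multiplication by \<open>c\<close> is written as the operator
    \<open>scalar_op c\<close>, which makes both sides visibly continuous in
    \<open>T\<close>.\<close>
  have "(bounded_ops :: ('h \<Rightarrow>\<^sub>L 'h) set)
      = (\<Inter>c. \<Inter>x. {T. blinfun_apply T (c *\<^sub>C x) = scalar_op c (blinfun_apply T x)})"
    by (auto simp: bounded_ops_iff scalar_op.rep_eq)
  also have "closed \<dots>"
    by (intro closed_INT ballI closed_Collect_eq continuous_intros)
  finally show ?thesis .
qed

text \<open>An \<open>e/2\<close>-net for the image of the unit ball under a compact operator within
  \<open>e/2\<close> of \<open>T\<close> is an \<open>e\<close>-net for its image under
  \<open>T\<close>.\<close>

lemma closed_compact_ops: "closed (compact_ops :: ('h::complex_hilbert \<Rightarrow>\<^sub>L 'h) set)"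
proof -
  have "T \<in> compact_ops" if T: "T \<in> closure compact_ops" for T :: "'h \<Rightarrow>\<^sub>L 'h"
    unfolding compact_ops_iff_totally_bounded
  proof safe
    have "closure compact_ops \<subseteq> (bounded_ops :: ('h \<Rightarrow>\<^sub>L 'h) set)"
      by (rule closure_minimal[OF _ closed_bounded_ops]) (auto simp: compact_ops_imp_bounded)
    then show "T \<in> bounded_ops" using T by blast
    fix e :: real assume e: "e > 0"
    obtain K where K: "K \<in> compact_ops" "dist K T < e / 2"
      using T e by (metis closure_approachable half_gt_zero)
    obtain F where F: "finite F" "blinfun_apply K ` cball 0 1 \<subseteq> (\<Union>y\<in>F. ball y (e/2))"
      using K(1)[unfolded compact_ops_iff_totally_bounded, THEN conjunct2, rule_format, of "e/2"] e by auto
    have "blinfun_apply T ` cball 0 1 \<subseteq> (\<Union>y\<in>F. ball y e)"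
    proof (clarsimp)
      fix x :: 'h assume x: "norm x \<le> 1"
      then have "K x \<in> (\<Union>y\<in>F. ball y (e/2))" by (intro subsetD[OF F(2)] imageI) simp
      then obtain y where y: "y \<in> F" "dist y (K x) < e / 2" by auto
      have "dist (K x) (T x) = norm ((K - T) x)" by (simp add: dist_norm blinfun.diff_left)
      also have "\<dots> \<le> norm (K - T) * norm x" by (rule norm_blinfun)
      also have "\<dots> \<le> norm (K - T) * 1" using x by (intro mult_left_mono) auto
      finally have "dist (K x) (T x) < e / 2" using K(2) by (simp add: dist_norm)
      then have "dist y (T x) < e" using y(2) dist_triangle[of y "T x" "K x"] by linarith
      then show "\<exists>y\<in>F. dist y (T x) < e" using y(1) by blast
    qed
    then show "\<exists>F. finite F \<and> blinfun_apply T ` cball 0 1 \<subseteq> (\<Union>y\<in>F. ball y e)"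
      using F(1) by blast
  qed
  then show ?thesis using closure_subset_eq by blast
qed

text \<open>The square of \<open>norm (S v)\<close> is \<open>cinner (adj S (S v)) v\<close>. So
  points of the unit ball with close images under \<open>adj S o\<^sub>L S\<close> have close images
  under \<open>S\<close>, and a net for the first operator yields one for the second.\<close>

lemma compact_ops_if_adj_compose:
  assumes S: "S \<in> bounded_ops" and A: "adj S o\<^sub>L S \<in> compact_ops"
  shows "S \<in> compact_ops"
  unfolding compact_ops_iff_totally_bounded
proof safe
  fix e :: real assume e: "e > 0"
  define A where "A = adj S o\<^sub>L S"
  \<comment> \<open>Images in one ball of radius \<open>d\<close> differ by less than
    \<open>2 * d\<close>, points of the unit ball by at most 2; the product of these bounds is
    \<open>4 * d\<close>, that is \<open>e\<^sup>2\<close>.\<close>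
  define d where "d = e\<^sup>2 / 4"
  have "d > 0" using e by (simp add: d_def)
  then obtain F where F: "finite F" "blinfun_apply A ` cball 0 1 \<subseteq> (\<Union>y\<in>F. ball y d)"
    using A unfolding A_def compact_ops_iff_totally_bounded by blast
  define c where "c y = (SOME x. norm x \<le> 1 \<and> A x \<in> ball y d)" for y
  have "blinfun_apply S ` cball 0 1 \<subseteq> (\<Union>y\<in>(\<lambda>y. S (c y)) ` F. ball y e)"
  proof (clarsimp)
    fix x :: 'a assume x: "norm x \<le> 1"
    then have "A x \<in> (\<Union>y\<in>F. ball y d)" by (intro subsetD[OF F(2)] imageI) simp
    then obtain y where y: "y \<in> F" "A x \<in> ball y d" by blast
    have c: "norm (c y) \<le> 1" "A (c y) \<in> ball y d"
      using someI[of "\<lambda>x. norm x \<le> 1 \<and> A x \<in> ball y d" x] x y(2) by (auto simp: c_def)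
    have "norm (A (c y - x)) = dist (A (c y)) (A x)" by (simp add: dist_norm blinfun.diff_right)
    also have "\<dots> < 2 * d" using c(2) y(2) dist_triangle2[of "A (c y)" "A x" y] by (simp add: dist_commute)
    finally have *: "norm (A (c y - x)) < 2 * d" .
    have n2: "norm (c y - x) \<le> 2" using norm_triangle_ineq4[of "c y" x] c(1) x by linarith
    have "(norm (S (c y - x)))\<^sup>2 = Re (cinner (A (c y - x)) (c y - x))"
      by (simp add: A_def cinner_adj_left[OF S] Re_cinner_self)
    also have "\<dots> \<le> norm (A (c y - x)) * norm (c y - x)" by (rule Re_cinner_le)
    also have "\<dots> \<le> norm (A (c y - x)) * 2" using n2 by (intro mult_left_mono) auto
    also have "\<dots> < e\<^sup>2" using * by (simp add: d_def)
    finally have "norm (S (c y - x)) < e" using e by (simp add: power_less_imp_less_base)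
    then show "\<exists>y\<in>F. dist (S (c y)) (S x) < e" using y(1) by (auto simp: dist_norm blinfun.diff_right)
  qed
  then show "\<exists>F. finite F \<and> blinfun_apply S ` cball 0 1 \<subseteq> (\<Union>y\<in>F. ball y e)" using F(1) by blast
qed (rule S)

lemma compact_ops_convergent_subseq:
  assumes "K \<in> compact_ops" "\<And>n. norm (x n) \<le> 1"
  obtains r :: "nat \<Rightarrow> nat" and l where "strict_mono r" "(\<lambda>n. blinfun_apply K (x (r n))) \<longlonglongrightarrow> l"
proof -
  have "compact (closure (blinfun_apply K ` cball 0 1))" using assms(1) by (simp add: compact_ops_def)
  moreover have "\<forall>n. K (x n) \<in> closure (blinfun_apply K ` cball 0 1)"
    using assms(2) by (intro allI subsetD[OF closure_subset] imageI) simp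
  ultimately obtain l r where "strict_mono r" "((\<lambda>n. K (x n)) \<circ> r) \<longlonglongrightarrow> l"
    unfolding compact_def by metis
  then show ?thesis using that by (simp add: o_def)
qed

section \<open>Subspaces of finite codimension\<close>

lemma bounded_bilinear_scaleC:
  "bounded_bilinear (scaleC :: complex \<Rightarrow> 'h \<Rightarrow> 'h::complex_hilbert)"
  by unfold_locales
    (auto simp: norm_scaleC scaleR_scaleC scaleC_add_left scaleC_add_right scaleC_scaleC
      scaleR_conv_of_real mult.commute intro!: exI[of _ 1])

text \<open>Induction on \<open>Y\<close>, for all \<open>M\<close> at once. Each vector of
  \<open>Y\<close> costs at most one dimension: the unit ball of \<open>M\<close> lies in a
  continuous image of the unit ball of the smaller subspace times a disc of scalars.\<close>

lemma compact_cball_if_compact_orth_compl: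
  fixes M :: "'h::complex_hilbert set"
  assumes "finite Y" "complex_vector.subspace M" "closed M"
    and "compact (M \<inter> orth_compl Y \<inter> cball 0 1)"
  shows "compact (M \<inter> cball 0 1)"
  using assms
proof (induction Y arbitrary: M rule: finite_induct)
  case empty
  then show ?case by (simp add: orth_compl_def)
next
  case (insert y Y)
  define M' where "M' = M \<inter> orth_compl {y}"
  have M': "complex_vector.subspace M'" "closed M'"
    using insert.prems csubspace_orth_compl closed_orth_compl
    by (auto simp: M'_def intro: complex_vector.subspace_inter closed_Int)
  have "M' \<inter> orth_compl Y = M \<inter> orth_compl (insert y Y)"
    by (auto simp: M'_def orth_compl_def)
  then have cM': "compact (M' \<inter> cball 0 1)" using insert.IH[OF M'] insert.prems(3) by simp
  show ?case
  proof (cases "M \<subseteq> orth_compl {y}")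
    case True
    then show ?thesis using cM' by (simp add: M'_def inf.absorb1)
  next
    case False
    then obtain x where x: "x \<in> M" "cinner x y \<noteq> 0" by (auto simp: orth_compl_def)
    \<comment> \<open>Normalised so that subtracting \<open>cinner z y *\<^sub>C u\<close> makes any
      \<open>z\<close> orthogonal to \<open>y\<close>. The number \<open>R\<close> below bounds the
      remainder for \<open>z\<close> in the unit ball.\<close>
    define u where "u = (1 / cinner x y) *\<^sub>C x"
    have u: "u \<in> M" "cinner u y = 1"
      using x insert.prems(1) by (auto simp: u_def cinner_scaleC_left complex_vector.subspace_scale)
    define R where "R = 1 + norm y * norm u"
    have R: "R > 0" by (simp add: R_def add_pos_nonneg)
    have "compact ((\<lambda>(v, c). R *\<^sub>R v + c *\<^sub>C u) ` ((M' \<inter> cball 0 1) \<times> cball 0 (norm y)))" (is "compact ?C")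
      by (intro compact_continuous_image compact_Times cM' compact_cball)
        (auto simp: case_prod_beta intro!: continuous_intros
          bounded_bilinear.continuous_on[OF bounded_bilinear_scaleC])
    moreover have "M \<inter> cball 0 1 \<subseteq> ?C"
    proof
      fix z assume z: "z \<in> M \<inter> cball 0 1"
      define c where "c = cinner z y"
      define v where "v = z - c *\<^sub>C u"
      have "cmod c \<le> norm z * norm y" unfolding c_def by (rule norm_cinner_le)
      also have "\<dots> \<le> 1 * norm y" using z by (intro mult_right_mono) auto
      finally have c: "cmod c \<le> norm y" by simp
      have "v \<in> M'" using z u insert.prems(1)
        by (auto simp: v_def M'_def orth_compl_def c_def cinner_simps
            intro: complex_vector.subspace_diff complex_vector.subspace_scale)
      moreover have "norm v \<le> R"
      proof -
        have "norm v \<le> norm z + cmod c * norm u"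
          unfolding v_def norm_scaleC[symmetric] by (rule norm_triangle_ineq4)
        also have "\<dots> \<le> 1 + norm y * norm u" using z c by (intro add_mono mult_right_mono) auto
        finally show ?thesis by (simp add: R_def)
      qed
      ultimately have "(1 / R) *\<^sub>R v \<in> M' \<inter> cball 0 1"
        using R M'(1) by (auto simp: csubspace_scaleR divide_simps)
      moreover have "z = R *\<^sub>R ((1 / R) *\<^sub>R v) + c *\<^sub>C u" using R by (simp add: v_def)
      ultimately show "z \<in> ?C" using c by (intro image_eqI[of _ _ "((1 / R) *\<^sub>R v, c)"]) auto
    qed
    moreover have "closed (M \<inter> cball 0 1)" using insert.prems(2) by auto
    ultimately show ?thesis by (metis compact_Int_closed inf.absorb_iff2)
  qed
qed

text \<open>\<open>Q\<close> is the orthogonal projection onto \<open>orth_compl Y\<close>. The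
  complementary projection maps the unit ball into that of the double complement, which meets
  \<open>orth_compl Y\<close> only in 0 and therefore has a compact unit ball.\<close>

lemma exists_cofinite_projection:
  fixes Y :: "'h::complex_hilbert set"
  assumes Y: "finite Y"
  obtains Q where "Q \<in> bounded_ops" "adj Q = Q" "norm Q \<le> 1" "\<And>x. blinfun_apply Q x \<in> orth_compl Y"
    "\<And>x. x \<in> orth_compl Y \<Longrightarrow> blinfun_apply Q x = x" "\<And>y. y \<in> Y \<Longrightarrow> blinfun_apply Q y = 0"
    "id_blinfun - Q \<in> compact_ops"
proof -
  let ?N = "orth_compl Y"
  obtain Q where Q: "Q \<in> bounded_ops" "adj Q = Q" "norm Q \<le> 1" "\<And>x. blinfun_apply Q x \<in> ?N"
    and orth: "\<And>x y. y \<in> ?N \<Longrightarrow> cinner (x - blinfun_apply Q x) y = 0"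
    using exists_projection_operator[OF csubspace_orth_compl closed_orth_compl] by blast
  have fixN: "Q x = x" if "x \<in> ?N" for x
  proof -
    have "x - Q x \<in> ?N" using that Q(4) csubspace_orth_compl complex_vector.subspace_diff by blast
    then have "cinner (x - Q x) (x - Q x) = 0" by (rule orth)
    then show ?thesis by (simp add: cinner_eq_zero_iff)
  qed
  have zero: "Q y = 0" if "y \<in> Y" for y
  proof -
    have "cinner (Q y) y = 0" using Q(4) that by (simp add: orth_compl_def)
    moreover have "cinner (y - Q y) (Q y) = 0" using Q(4) by (rule orth)
    ultimately have "cinner (Q y) (Q y) = 0"
      by (simp add: cinner_diff_left) (simp add: cinner_eq_zero_commute)
    then show ?thesis by (simp add: cinner_eq_zero_iff)
  qed
  let ?M = "orth_compl ?N"
  have "x = 0" if "x \<in> ?M" "x \<in> ?N" for x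
  proof -
    have "cinner x x = 0" using that unfolding orth_compl_def[of ?N] by blast
    then show ?thesis by (simp add: cinner_eq_zero_iff)
  qed
  then have "?M \<inter> ?N \<inter> cball 0 1 \<subseteq> {0}" by blast
  then have "compact (?M \<inter> ?N \<inter> cball 0 1)"
    by (meson finite.emptyI finite.insertI finite_imp_compact finite_subset)
  then have cM: "compact (?M \<inter> cball 0 1)"
    by (rule compact_cball_if_compact_orth_compl[OF Y csubspace_orth_compl closed_orth_compl])
  have "id_blinfun - Q \<in> compact_ops"
  proof (rule compact_ops_subset[OF _ _ cM])
    show "blinfun_apply (id_blinfun - Q) ` cball 0 1 \<subseteq> ?M \<inter> cball 0 1"
    proof (rule image_subsetI)
      fix x :: 'h assume x: "x \<in> cball 0 1"
      have "x - Q x \<in> ?M" using orth unfolding orth_compl_def[of ?N] by blast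
      moreover have "cinner (x - Q x) (Q x) = 0" using Q(4) by (rule orth)
      then have "(norm x)\<^sup>2 = (norm (x - Q x))\<^sup>2 + (norm (Q x))\<^sup>2"
        using power2_norm_add[of "x - Q x" "Q x"] by simp
      then have "(norm (x - Q x))\<^sup>2 \<le> (norm x)\<^sup>2" by simp
      then have "norm (x - Q x) \<le> norm x" by simp
      ultimately show "blinfun_apply (id_blinfun - Q) x \<in> ?M \<inter> cball 0 1"
        using x by (simp add: blinfun.diff_left)
    qed
  qed (simp add: Q)
  then show ?thesis using Q fixN zero that by blast
qed

section \<open>Perturbed scalars that are absolutely norm attaining\<close>

lemma bdd_above_norm_on:
  "bdd_above ((\<lambda>x. norm (blinfun_apply T x)) ` {x \<in> M. norm x \<le> 1})"
proof (rule bdd_aboveI2)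
  fix x assume "x \<in> {x \<in> M. norm x \<le> 1}"
  then have "norm T * norm x \<le> norm T * 1" by (intro mult_left_mono) auto
  then show "norm (T x) \<le> norm T" using norm_blinfun[of T x] by simp
qed

lemma norm_on_upper: "x \<in> M \<Longrightarrow> norm x \<le> 1 \<Longrightarrow> norm (blinfun_apply T x) \<le> norm_on M T"
  unfolding norm_on_def by (intro cSUP_upper bdd_above_norm_on) auto

text \<open>Let \<open>s\<close> be the norm on \<open>M\<close> and \<sigma> the difference of
  \<open>s\<^sup>2\<close> and \<alpha>. If \<sigma> > 0, compactness of \<open>G\<close> makes a
  subsequence of a maximising sequence converge. Otherwise any unit vector of \<open>M\<close> in
  \<open>orth_compl Z\<close> attains the norm, and if there is none, the unit sphere of
  \<open>M\<close> is compact.\<close>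

lemma AN_opsI:
  fixes T G :: "'h::complex_hilbert \<Rightarrow>\<^sub>L 'h"
  assumes T: "T \<in> bounded_ops" and G: "G \<in> compact_ops"
    and form: "\<And>x. (norm (T x))\<^sup>2 = \<alpha> * (norm x)\<^sup>2 + Re (cinner (G x) x)"
    and Z: "finite Z" and pos: "\<And>x. x \<in> orth_compl Z \<Longrightarrow> Re (cinner (G x) x) \<ge> 0"
  shows "T \<in> AN_ops"
proof -
  have "norm_attaining_on M T" if M: "complex_vector.subspace M" "closed M" "M \<noteq> {0}" for M
  proof -
    define q where "q x = Re (cinner (G x) x)" for x
    define s where "s = norm_on M T"
    define \<sigma> where "\<sigma> = s\<^sup>2 - \<alpha>"
    have M0: "0 \<in> M" using M(1) by (rule complex_vector.subspace_0)
    have up: "norm (T x) \<le> s" if "x \<in> M" "norm x \<le> 1" for x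
      unfolding s_def using that by (rule norm_on_upper)
    have s0: "s \<ge> 0" using up[OF M0] by simp
    have up': "norm (T x) \<le> s * norm x" if "x \<in> M" for x
    proof (cases "x = 0")
      case False
      have "norm (T ((1 / norm x) *\<^sub>R x)) \<le> s"
        using False that M(1) by (intro up csubspace_scaleR) auto
      then show ?thesis using False by (simp add: blinfun.scaleR_right divide_simps)
    qed simp
    have q_le: "q x \<le> \<sigma> * (norm x)\<^sup>2" if "x \<in> M" for x
    proof -
      have "(norm (T x))\<^sup>2 \<le> (s * norm x)\<^sup>2" using up'[OF that] by (intro power_mono) auto
      then show ?thesis using form[of x] by (simp add: q_def \<sigma>_def power_mult_distrib algebra_simps)
    qed
    have attained: "norm_attaining_on M T" if "x \<in> M" "norm x = 1" "s \<le> norm (T x)" for x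
      unfolding norm_attaining_on_def using that up[of x] by (intro bexI[of _ x]) (auto simp: s_def)
    have "\<exists>x\<in>M. norm x = 1 \<and> s - 1 / real (Suc n) < norm (T x)" for n
    proof -
      have ne: "{x \<in> M. norm x \<le> 1} \<noteq> {}" using M0 by auto
      have "s - 1 / real (Suc n) < (SUP x\<in>{x \<in> M. norm x \<le> 1}. norm (T x))"
        unfolding s_def norm_on_def by simp
      then obtain x where x: "x \<in> M" "norm x \<le> 1" "s - 1 / real (Suc n) < norm (T x)"
        unfolding less_cSUP_iff[OF ne bdd_above_norm_on] by blast
      obtain w where w: "w \<in> M" "w \<noteq> 0" using M(3) M0 by blast
      \<comment> \<open>A near-maximiser equal to 0 cannot be normalised; its value is 0, so any
        nonzero vector of \<open>M\<close> does as well.\<close>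
      define v where "v = (if x = 0 then w else x)"
      have v: "v \<noteq> 0" "v \<in> M" using w x by (auto simp: v_def)
      have "norm (T x) \<le> norm (T ((1 / norm v) *\<^sub>R v))"
        using x(2) v(1) by (auto simp: v_def blinfun.scaleR_right divide_simps mult_left_le)
      then show ?thesis using v x(3) M(1)
        by (intro bexI[of _ "(1 / norm v) *\<^sub>R v"]) (auto intro: csubspace_scaleR)
    qed
    then obtain x where x: "\<And>n. x n \<in> M" "\<And>n. norm (x n) = 1" "\<And>n. s - 1 / real (Suc n) < norm (T (x n))"
      by metis
    have lim: "(\<lambda>n. norm (T (x n))) \<longlonglongrightarrow> s"
    proof (rule tendsto_sandwich[of "\<lambda>n. s - 1 / real (Suc n)" _ _ "\<lambda>_. s"])
      show "(\<lambda>n. s - 1 / real (Suc n)) \<longlonglongrightarrow> s"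
        using tendsto_diff[OF tendsto_const[of s] LIMSEQ_inverse_real_of_nat] by (simp add: divide_inverse)
    qed (auto intro!: eventuallyI less_imp_le[OF x(3)] up x simp del: of_nat_Suc simp: x)
    have q_lim: "(\<lambda>n. q (x n)) \<longlonglongrightarrow> \<sigma>"
    proof -
      have "q (x n) = (norm (T (x n)))\<^sup>2 - \<alpha>" for n using form[of "x n"] x(2) by (simp add: q_def)
      then show ?thesis unfolding \<sigma>_def by (simp, intro tendsto_intros lim)
    qed
    show ?thesis
    proof (cases "\<sigma> > 0")
      case True
      obtain r l where r: "strict_mono r" and l: "(\<lambda>n. G (x (r n))) \<longlonglongrightarrow> l"
        using compact_ops_convergent_subseq[OF G, of x] x(2) by (metis order_refl)
      define y where "y n = x (r n)" for n
      have y: "y n \<in> M" "norm (y n) = 1" for n using x by (auto simp: y_def)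
      have qy: "(\<lambda>n. q (y n)) \<longlonglongrightarrow> \<sigma>"
        using LIMSEQ_subseq_LIMSEQ[OF q_lim r] by (simp add: o_def y_def)
      \<comment> \<open>Parallelogram identity for \<open>q\<close>, with \<open>q_le\<close>
        bounding the value at the sum. The value at the difference is small when the images under
        \<open>G\<close> are close, so near-maximisers are then close to each other.\<close>
      have est: "\<sigma> * (norm (y i - y j))\<^sup>2 \<le> 4 * \<sigma> - 2 * q (y i) - 2 * q (y j) + 2 * dist (G (y i)) (G (y j))"
        for i j
      proof -
        have "q (y i + y j) + q (y i - y j) = 2 * q (y i) + 2 * q (y j)"
          by (simp add: q_def blinfun.bilinear_simps cinner_simps)
        moreover have "q (y i - y j) \<le> 2 * dist (G (y i)) (G (y j))"
        proof -
          have "q (y i - y j) \<le> norm (G (y i - y j)) * norm (y i - y j)"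
            unfolding q_def by (rule Re_cinner_le)
          also have "\<dots> \<le> norm (G (y i - y j)) * 2"
            using norm_triangle_ineq4[of "y i" "y j"] y by (intro mult_left_mono) auto
          finally show ?thesis by (simp add: dist_norm blinfun.diff_right)
        qed
        moreover have "q (y i + y j) \<le> \<sigma> * (norm (y i + y j))\<^sup>2"
          using M(1) y by (intro q_le complex_vector.subspace_add) auto
        moreover have "\<sigma> * (norm (y i + y j))\<^sup>2 = 4 * \<sigma> - \<sigma> * (norm (y i - y j))\<^sup>2"
          using norm_parallelogram[of "y i" "y j"] y by (simp add: algebra_simps flip: distrib_left)
        ultimately show ?thesis by linarith
      qed
      have "Cauchy y"
      proof (rule metric_CauchyI)
        fix e :: real assume e: "e > 0"
        \<comment> \<open>With both values above \<open>\<sigma> - d\<close> and images under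
          \<open>G\<close> within \<open>d\<close>, the right side of \<open>est\<close> is below
          \<open>6 * d\<close>.\<close>
        define d where "d = \<sigma> * e\<^sup>2 / 6"
        have d: "d > 0" using e True by (simp add: d_def)
        have "eventually (\<lambda>n. \<sigma> - d < q (y n)) sequentially"
          using d by (intro order_tendstoD(1)[OF qy]) auto
        then obtain N1 where N1: "\<And>n. n \<ge> N1 \<Longrightarrow> \<sigma> - d < q (y n)" by (auto simp: eventually_sequentially)
        obtain N2 where N2: "\<And>i j. i \<ge> N2 \<Longrightarrow> j \<ge> N2 \<Longrightarrow> dist (G (y i)) (G (y j)) < d"
          using metric_CauchyD[OF LIMSEQ_imp_Cauchy[OF l] d] unfolding y_def by blast
        have "dist (y i) (y j) < e" if "i \<ge> max N1 N2" "j \<ge> max N1 N2" for i j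
        proof -
          have "\<sigma> * (norm (y i - y j))\<^sup>2 < \<sigma> * e\<^sup>2"
            using est[of i j] N1[of i] N1[of j] N2[of i j] that by (simp add: d_def)
          then have "(norm (y i - y j))\<^sup>2 < e\<^sup>2" using True by simp
          then show ?thesis using e by (simp add: dist_norm power_less_imp_less_base)
        qed
        then show "\<exists>N. \<forall>i\<ge>N. \<forall>j\<ge>N. dist (y i) (y j) < e" by blast
      qed
      then obtain z where z: "y \<longlonglongrightarrow> z" by (auto simp: convergent_eq_Cauchy[symmetric])
      have "(\<lambda>n. norm (y n)) \<longlonglongrightarrow> norm z" by (intro tendsto_intros z)
      then have "norm z = 1" using y(2) by (simp add: LIMSEQ_const_iff)
      moreover have "z \<in> M" using closed_sequentially[OF M(2) _ z] y(1) by blast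
      moreover have "(\<lambda>n. norm (T (y n))) \<longlonglongrightarrow> norm (T z)" by (intro tendsto_intros z)
      then have "norm (T z) = s"
        using LIMSEQ_subseq_LIMSEQ[OF lim r] LIMSEQ_unique by (fastforce simp: o_def y_def)
      ultimately show ?thesis by (intro attained) auto
    next
      case False
      show ?thesis
      proof (cases "\<exists>v\<in>M. v \<in> orth_compl Z \<and> v \<noteq> 0")
        case True
        then obtain v where v: "v \<in> M" "v \<in> orth_compl Z" "v \<noteq> 0" by blast
        define u where "u = (1 / norm v) *\<^sub>R v"
        have u: "u \<in> M" "u \<in> orth_compl Z" "norm u = 1"
          using v M(1) by (auto simp: u_def csubspace_scaleR csubspace_scaleR[OF csubspace_orth_compl])
        \<comment> \<open>Here \<sigma> \<le> 0, so \<open>s\<^sup>2\<close> is at most \<alpha>,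
          while the squared norm of \<open>T u\<close> is at least \<alpha>.\<close>
        have "s\<^sup>2 \<le> (norm (T u))\<^sup>2" using form[of u] pos[OF u(2)] u(3) False by (simp add: \<sigma>_def)
        then have "s \<le> norm (T u)" by (rule power2_le_imp_le) simp
        then show ?thesis using u by (intro attained)
      next
        case False
        then have "M \<inter> orth_compl Z \<inter> cball 0 1 \<subseteq> {0}" by blast
        then have "compact (M \<inter> orth_compl Z \<inter> cball 0 1)"
          by (meson finite.emptyI finite.insertI finite_imp_compact finite_subset)
        then have "compact (M \<inter> cball 0 1)"
          by (rule compact_cball_if_compact_orth_compl[OF Z M(1,2)])
        then have "compact ((M \<inter> cball 0 1) \<inter> {z. norm z = 1})"
            by (rule compact_Int_closed) (intro closed_Collect_eq continuous_intros)
        moreover have "(M \<inter> cball 0 1) \<inter> {z. norm z = 1} \<noteq> {}" using x by force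
        moreover have "continuous_on ((M \<inter> cball 0 1) \<inter> {z. norm z = 1}) (\<lambda>z. norm (T z))"
          by (intro continuous_intros)
        ultimately obtain z where z: "z \<in> (M \<inter> cball 0 1) \<inter> {z. norm z = 1}"
          and max: "\<And>w. w \<in> (M \<inter> cball 0 1) \<inter> {z. norm z = 1} \<Longrightarrow> norm (T w) \<le> norm (T z)"
          using continuous_attains_sup by metis
        have "s \<le> norm (T z)" by (rule LIMSEQ_le_const2[OF lim]) (use max x in auto)
        then show ?thesis using z by (intro attained) auto
      qed
    qed
  qed
  then show ?thesis using T by (simp add: AN_ops_def)
qed


section \<open>Removing a small perturbation by congruence\<close>

lemma blinfun_compose_assoc: "(A o\<^sub>L B) o\<^sub>L C = A o\<^sub>L (B o\<^sub>L C)"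
  by (rule blinfun_eqI) simp

lemma adj_eq_self_iff:
  assumes "T \<in> bounded_ops"
  shows "adj T = T \<longleftrightarrow> (\<forall>x y. cinner (blinfun_apply T x) y = cinner x (T y))"
  using assms by (metis adj_unique cinner_adj_right)

lemma norm_blinfun_le_if_unit:
  fixes T :: "'h::complex_hilbert \<Rightarrow>\<^sub>L 'h"
  assumes "\<And>x. norm x \<le> 1 \<Longrightarrow> norm (T x) \<le> b"
  shows "norm T \<le> b"
proof (rule norm_blinfun_bound)
  show "0 \<le> b" using assms[of 0] by simp
  fix x
  show "norm (T x) \<le> b * norm x"
  proof (cases "x = 0")
    case False
    have "norm (T ((1 / norm x) *\<^sub>R x)) \<le> b" using False by (intro assms) simp
    then show ?thesis using False by (simp add: blinfun.scaleR_right divide_simps)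
  qed simp
qed

text \<open>Banach's fixed point theorem yields \<open>C\<close>. The operator \<open>1 + C\<close> plays the role of an inverse square
  root of \<open>1 + E\<close>; the symmetric form of the equation keeps the iterates self-adjoint without any
  commutation of \<open>C\<close> and \<open>E\<close>.\<close>

lemma exists_selfadjoint_congruence:
  fixes E :: "'h::complex_hilbert \<Rightarrow>\<^sub>L 'h"
  assumes E: "E \<in> bounded_ops" "adj E = E" and r: "0 < r" "r \<le> 1 / 2" and nE: "norm E \<le> r / 4"
  shows "\<exists>C\<in>bounded_ops. adj C = C \<and> norm C \<le> r
    \<and> (id_blinfun + C) o\<^sub>L (id_blinfun + E) o\<^sub>L (id_blinfun + C) = id_blinfun"
proof -
  \<comment> \<open>Expanding \<open>(1 + C) (1 + E) (1 + C) = 1\<close> and solving for the linear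
    term \<open>2 * C\<close> gives \<open>C = f C\<close>.\<close>
  define f where "f C = (- 1 / 2) *\<^sub>R (E + (C o\<^sub>L E) + (E o\<^sub>L C) + (C o\<^sub>L C) + (C o\<^sub>L E o\<^sub>L C))" for C
  \<comment> \<open>Symmetry is imposed as a closed condition, so that \<open>S\<close> is complete.
    The bounds \<open>norm C \<le> r \<le> 1/2\<close> and \<open>norm E \<le> r/4\<close> make
    \<open>f\<close> map \<open>S\<close> into itself and contract by the factor 11/16.\<close>
  define S where "S = bounded_ops \<inter> (\<Inter>x. \<Inter>y. {C :: 'h \<Rightarrow>\<^sub>L 'h. cinner (C x) y = cinner x (C y)}) \<inter> cball 0 r"
  have S_iff: "C \<in> S \<longleftrightarrow> C \<in> bounded_ops \<and> (\<forall>x y. cinner (C x) y = cinner x (C y)) \<and> norm C \<le> r" for C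
    by (auto simp: S_def)
  have E_sym: "cinner (E x) y = cinner x (E y)" for x y
    using E adj_eq_self_iff by blast
  have "closed S" unfolding S_def
    by (intro closed_Int closed_INT ballI closed_Collect_eq continuous_intros closed_bounded_ops closed_cball)
  then have "complete S" by (simp add: complete_eq_closed)
  moreover have "0 \<in> S" using r by (simp add: S_iff)
  then have "S \<noteq> {}" by blast
  moreover have "f C \<in> S" if C: "C \<in> S" for C
    unfolding S_iff
  proof (intro conjI allI)
    show "f C \<in> bounded_ops" using C E by (simp add: f_def S_iff)
    have C_sym: "cinner (C x) y = cinner x (C y)" for x y using C by (simp add: S_iff)
    show "cinner (f C x) y = cinner x (f C y)" for x y
      by (simp add: f_def blinfun.bilinear_simps cinner_simps E_sym C_sym)
    have nC: "norm C \<le> r" "norm C \<le> 1 / 2" using C r by (auto simp: S_iff)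
    have "norm (C o\<^sub>L E) \<le> (1 / 2) * (r / 4)" "norm (E o\<^sub>L C) \<le> (r / 4) * (1 / 2)"
      "norm (C o\<^sub>L C) \<le> (1 / 2) * r" "norm (C o\<^sub>L E o\<^sub>L C) \<le> (1 / 2) * (r / 4) * (1 / 2)"
      using nC nE r by (intro order_trans[OF norm_blinfun_compose] mult_mono; simp)+
    moreover have "norm (f C) \<le> (norm E + norm (C o\<^sub>L E) + norm (E o\<^sub>L C) + norm (C o\<^sub>L C)
        + norm (C o\<^sub>L E o\<^sub>L C)) / 2"
      unfolding f_def by (simp, intro norm_triangle_le add_right_mono order_refl)
    ultimately show "norm (f C) \<le> r" using nE r by (simp add: field_simps)
  qed
  moreover have "dist (f C) (f D) \<le> 11 / 16 * dist C D" if C: "C \<in> S" and D: "D \<in> S" for C D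
  proof -
    define B where "B = C - D"
    have CD: "norm C \<le> 1 / 2" "norm D \<le> 1 / 2" using C D r by (auto simp: S_iff)
    have "f C - f D = (- 1 / 2) *\<^sub>R ((B o\<^sub>L E) + (E o\<^sub>L B) + (C o\<^sub>L B) + (B o\<^sub>L D)
        + (C o\<^sub>L E o\<^sub>L B) + (B o\<^sub>L E o\<^sub>L D))"
      unfolding f_def B_def by (rule blinfun_eqI) (simp add: blinfun.bilinear_simps algebra_simps)
    then have "norm (f C - f D) \<le> (norm (B o\<^sub>L E) + norm (E o\<^sub>L B) + norm (C o\<^sub>L B) + norm (B o\<^sub>L D)
        + norm (C o\<^sub>L E o\<^sub>L B) + norm (B o\<^sub>L E o\<^sub>L D)) / 2"
      by (simp, intro norm_triangle_le add_right_mono order_refl)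
    moreover have "norm (B o\<^sub>L E) \<le> norm B * (1 / 8)" "norm (E o\<^sub>L B) \<le> (1 / 8) * norm B"
      "norm (C o\<^sub>L B) \<le> (1 / 2) * norm B" "norm (B o\<^sub>L D) \<le> norm B * (1 / 2)"
      "norm (C o\<^sub>L E o\<^sub>L B) \<le> (1 / 2) * (1 / 8) * norm B"
      "norm (B o\<^sub>L E o\<^sub>L D) \<le> norm B * (1 / 8) * (1 / 2)"
      using CD nE r by (intro order_trans[OF norm_blinfun_compose] mult_mono; simp)+
    ultimately have "norm (f C - f D) \<le> 11 / 16 * norm B" by (simp add: field_simps)
    then show ?thesis by (simp add: dist_norm B_def)
  qed
  ultimately have "\<exists>!C\<in>S. f C = C"
    by (intro Banach_fix[where c = "11 / 16"]) auto
  then obtain C where C: "C \<in> S" "f C = C" by blast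
  have "(id_blinfun + C) o\<^sub>L (id_blinfun + E) o\<^sub>L (id_blinfun + C) = id_blinfun"
  proof (rule blinfun_eqI)
    fix x
    have "(-2) *\<^sub>R C x = (-2) *\<^sub>R f C x" using C(2) by simp
    also have "\<dots> = E x + C (E x) + E (C x) + C (C x) + C (E (C x))"
      by (simp add: f_def blinfun.bilinear_simps)
    finally have "C x + C x + (E x + C (E x) + E (C x) + C (C x) + C (E (C x))) = 0"
      by (metis add.commute add.right_inverse scaleR_2 scaleR_minus_left)
    then show "blinfun_apply ((id_blinfun + C) o\<^sub>L (id_blinfun + E) o\<^sub>L (id_blinfun + C)) x = blinfun_apply id_blinfun x"
      by (simp add: blinfun.bilinear_simps algebra_simps)
  qed
  then show ?thesis using C(1) adj_unique[of C C] by (auto simp: S_iff)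
qed

text \<open>Take \<open>Y\<close> to be a finite net for the image of the unit ball and
  \<open>Q\<close> the projection onto its complement. Since \<open>Q\<close> kills the net,
  \<open>Q o\<^sub>L K\<close> is small, and \<open>K\<close> differs little from its compression
  \<open>F\<close> by \<open>id_blinfun - Q\<close>.\<close>

lemma compact_selfadjoint_approx:
  fixes K :: "'h::complex_hilbert \<Rightarrow>\<^sub>L 'h"
  assumes K: "K \<in> compact_ops" "adj K = K" and e: "e > 0"
  obtains E F Y where "E \<in> bounded_ops" "adj E = E" "norm E \<le> e" "F \<in> compact_ops" "K = E + F"
    "finite Y" "\<And>x. x \<in> orth_compl Y \<Longrightarrow> blinfun_apply F x = 0"
proof -
  have Kb: "K \<in> bounded_ops" using K(1) by (rule compact_ops_imp_bounded)
  obtain Y where Y: "finite Y" "blinfun_apply K ` cball 0 1 \<subseteq> (\<Union>y\<in>Y. ball y (e/3))"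
    using K(1)[unfolded compact_ops_iff_totally_bounded, THEN conjunct2, rule_format, of "e/3"] e by auto
  obtain Q where Q: "Q \<in> bounded_ops" "adj Q = Q" "norm Q \<le> 1"
    and Q_fix: "\<And>x. x \<in> orth_compl Y \<Longrightarrow> blinfun_apply Q x = x" and Q_zero: "\<And>y. y \<in> Y \<Longrightarrow> blinfun_apply Q y = 0"
    using exists_cofinite_projection[OF Y(1)] by metis
  have QK: "norm (Q o\<^sub>L K) \<le> e / 3"
  proof (rule norm_blinfun_le_if_unit)
    fix x :: 'h assume "norm x \<le> 1"
    then have "K x \<in> (\<Union>y\<in>Y. ball y (e/3))" by (intro subsetD[OF Y(2)] imageI) simp
    then obtain y where y: "y \<in> Y" "norm (K x - y) < e / 3" by (auto simp: dist_norm norm_minus_commute)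
    have "blinfun_apply (Q o\<^sub>L K) x = Q (K x - y)" using Q_zero[OF y(1)] by (simp add: blinfun.diff_right)
    also have "norm \<dots> \<le> norm Q * norm (K x - y)" by (rule norm_blinfun)
    also have "\<dots> \<le> 1 * (e / 3)" using Q(3) y(2) by (intro mult_mono) auto
    finally show "norm (blinfun_apply (Q o\<^sub>L K) x) \<le> e / 3" by simp
  qed
  define P where "P = id_blinfun - Q"
  have P: "P \<in> bounded_ops" "adj P = P" using Q by (auto simp: P_def adj_diff)
  define F where "F = P o\<^sub>L K o\<^sub>L P"
  define E where "E = K - F"
  have E_eq: "E = (Q o\<^sub>L K) + (K o\<^sub>L Q) - (Q o\<^sub>L K o\<^sub>L Q)"
    unfolding E_def F_def P_def by (rule blinfun_eqI) (simp add: blinfun.bilinear_simps algebra_simps)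
  \<comment> \<open>\<open>K o\<^sub>L Q\<close> is the adjoint of \<open>Q o\<^sub>L K\<close>, as
    both factors are self-adjoint.\<close>
  have KQ: "norm (K o\<^sub>L Q) \<le> e / 3"
    using norm_adj_le[of "Q o\<^sub>L K"] QK K(2) Q Kb by (simp add: adj_compose)
  have QKQ: "norm (Q o\<^sub>L K o\<^sub>L Q) \<le> e / 3 * 1"
    using QK Q(3) e by (intro order_trans[OF norm_blinfun_compose[of "Q o\<^sub>L K"]] mult_mono) auto
  show ?thesis
  proof (rule that)
    show "norm E \<le> e"
      using QK KQ QKQ norm_triangle_ineq4[of "(Q o\<^sub>L K) + (K o\<^sub>L Q)" "Q o\<^sub>L K o\<^sub>L Q"]
        norm_triangle_ineq[of "Q o\<^sub>L K" "K o\<^sub>L Q"]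
      unfolding E_eq by linarith
    show "F \<in> compact_ops" unfolding F_def
      by (intro compact_ops_compose_left compact_ops_compose_right K P)
    show "E \<in> bounded_ops" unfolding E_def F_def using Kb P by simp
    have "adj F = F"
      unfolding F_def using Kb P K(2) by (simp add: adj_compose blinfun_compose_assoc)
    then show "adj E = E" unfolding E_def using Kb P K(2) by (simp add: adj_diff F_def)
    show "F x = 0" if "x \<in> orth_compl Y" for x
      using Q_fix[OF that] by (simp add: F_def P_def blinfun.bilinear_simps)
  qed (simp_all add: E_def Y)
qed

lemma closure_AN_opsI:
  fixes T :: "'h::complex_hilbert \<Rightarrow>\<^sub>L 'h"
  assumes T: "T \<in> bounded_ops" and K: "(adj T o\<^sub>L T) - \<alpha> *\<^sub>R id_blinfun \<in> compact_ops"
  shows "T \<in> closure AN_ops"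
proof -
  define K where "K = (adj T o\<^sub>L T) - \<alpha> *\<^sub>R id_blinfun"
  have form: "(norm (T x))\<^sup>2 = \<alpha> * (norm x)\<^sup>2 + Re (cinner (K x) x)" for x
    by (simp add: K_def blinfun.bilinear_simps cinner_simps cinner_adj_left[OF T] Re_cinner_self)
  show ?thesis
  proof (cases "\<alpha> \<le> 0")
    case True
    \<comment> \<open>For \<alpha> \<le> 0 the form of \<open>K\<close> is nonnegative everywhere,
      so the empty set serves as \<open>Z\<close>.\<close>
    have "T \<in> AN_ops"
    proof (rule AN_opsI[OF T assms(2)[folded K_def] form, of "{}"])
      fix x :: 'h
      have "\<alpha> * (norm x)\<^sup>2 \<le> 0" using True by (simp add: mult_nonpos_nonneg)
      then show "Re (cinner (K x) x) \<ge> 0" using form[of x] zero_le_power2[of "norm (T x)"] by linarith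
    qed simp
    then show ?thesis using closure_subset by blast
  next
    case False
    show ?thesis unfolding closure_approachable
    proof (intro allI impI)
      fix e :: real assume e: "e > 0"
      \<comment> \<open>The bound 1/2 is what the congruence requires; the other one makes
        \<open>norm T * norm C\<close> less than \<open>e\<close>, with \<open>+ 1\<close> keeping
        the denominator positive.\<close>
      define r where "r = min (1 / 2) (e / (2 * (norm T + 1)))"
      have nT: "norm T + 1 > 0" using norm_ge_zero[of T] by linarith
      then have "0 < e / (2 * (norm T + 1))" using e by simp
      then have r: "0 < r" "r \<le> 1 / 2" "r \<le> e / (2 * (norm T + 1))"
        by (simp_all only: r_def min.cobounded1 min.cobounded2 min_less_iff_conj) simp
      have K_sym: "adj K = K" unfolding K_def using T by (simp add: adj_diff adj_compose_self adj_scaleR)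
      obtain E F Y where E: "E \<in> bounded_ops" "adj E = E" "norm E \<le> \<alpha> * r / 4"
        and F: "F \<in> compact_ops" and EF: "K = E + F"
        and Y: "finite Y" "\<And>x. x \<in> orth_compl Y \<Longrightarrow> blinfun_apply F x = 0"
      proof (rule compact_selfadjoint_approx[OF assms(2)[folded K_def] K_sym, of "\<alpha> * r / 4"])
        show "0 < \<alpha> * r / 4" using False r by simp
      qed blast
      define E' where "E' = (1 / \<alpha>) *\<^sub>R E"
      have E': "E' \<in> bounded_ops" "adj E' = E'" "norm E' \<le> r / 4" "E = \<alpha> *\<^sub>R E'"
        using E False by (auto simp: E'_def adj_scaleR divide_simps mult.commute)
      obtain C where C: "C \<in> bounded_ops" "adj C = C" "norm C \<le> r"
        and cong: "(id_blinfun + C) o\<^sub>L (id_blinfun + E') o\<^sub>L (id_blinfun + C) = id_blinfun"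
        using exists_selfadjoint_congruence[OF E'(1,2) r(1,2) E'(3)] by blast
      define R where "R = id_blinfun + C"
      have R: "R \<in> bounded_ops" "adj R = R" using C by (auto simp: R_def adj_add)
      have R_sym: "cinner (R x) y = cinner x (R y)" for x y using R adj_eq_self_iff by blast
      have R_cong: "R (R x + E' (R x)) = x" for x
        using arg_cong[OF cong, of "\<lambda>B. blinfun_apply B x"]
        by (simp add: R_def blinfun.add_left)
      have "T o\<^sub>L R \<in> AN_ops"
      proof (rule AN_opsI)
        show "T o\<^sub>L R \<in> bounded_ops" using T R by simp
        show "R o\<^sub>L F o\<^sub>L R \<in> compact_ops"
          by (intro compact_ops_compose_left compact_ops_compose_right F R)
        show "finite (blinfun_apply R ` Y)" using Y by simp
        fix x
        have "(norm ((T o\<^sub>L R) x))\<^sup>2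
            = \<alpha> * Re (cinner (R x + E' (R x)) (R x)) + Re (cinner (F (R x)) (R x))"
          using form[of "R x"]
          by (simp add: EF E'(4) blinfun.bilinear_simps cinner_simps Re_cinner_self algebra_simps)
        also have "cinner (R x + E' (R x)) (R x) = cinner x x" by (simp add: R_sym[symmetric] R_cong)
        finally show "(norm ((T o\<^sub>L R) x))\<^sup>2 = \<alpha> * (norm x)\<^sup>2 + Re (cinner ((R o\<^sub>L F o\<^sub>L R) x) x)"
          by (simp add: Re_cinner_self R_sym)
      next
        fix x assume "x \<in> orth_compl (blinfun_apply R ` Y)"
        \<comment> \<open>By symmetry, \<open>R\<close> maps the complement of the image of
          \<open>Y\<close> into the complement of \<open>Y\<close>, where \<open>F\<close> vanishes;
          the compact form is 0 there.\<close>
        then have "R x \<in> orth_compl Y" by (simp add: orth_compl_def R_sym)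
        then show "Re (cinner ((R o\<^sub>L F o\<^sub>L R) x) x) \<ge> 0" by (simp add: Y)
      qed
      moreover have "dist (T o\<^sub>L R) T < e"
      proof -
        have "dist (T o\<^sub>L R) T = norm (T o\<^sub>L C)"
          by (simp add: dist_norm R_def blinfun_compose_simps)
            (metis blinfun_apply_blinfun_compose blinfun_eqI add_diff_cancel_left' id_blinfun.rep_eq)
        also have "\<dots> \<le> norm T * norm C" by (rule norm_blinfun_compose)
        also have "\<dots> \<le> (norm T + 1) * (e / (2 * (norm T + 1)))" using C(3) r by (intro mult_mono) auto
        also have "\<dots> < e" using nT e by (simp add: field_simps add_pos_nonneg)
        finally show ?thesis .
      qed
      ultimately show "\<exists>S\<in>AN_ops. dist S T < e" by blast
    qed
  qed
qed


section \<open>Concentration of the quadratic form on cofinite subspaces\<close>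

lemma csubspace_closure:
  fixes M :: "'h::complex_hilbert set"
  assumes M: "complex_vector.subspace M"
  shows "complex_vector.subspace (closure M)"
  unfolding csubspace_iff
proof (intro conjI ballI allI)
  show "0 \<in> closure M" using complex_vector.subspace_0[OF M] closure_subset by blast
next
  fix x y assume "x \<in> closure M" "y \<in> closure M"
  then obtain f g where "\<And>n. f n \<in> M" "f \<longlonglongrightarrow> x" "\<And>n. g n \<in> M" "g \<longlonglongrightarrow> y"
    unfolding closure_sequential by blast
  then show "x + y \<in> closure M" unfolding closure_sequential
    by (intro exI[of _ "\<lambda>n. f n + g n"]) (auto intro: tendsto_add complex_vector.subspace_add[OF M])
next
  fix c x assume "x \<in> closure M"
  then obtain f where "\<And>n. f n \<in> M" "f \<longlonglongrightarrow> x" unfolding closure_sequential by blast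
  then show "c *\<^sub>C x \<in> closure M" unfolding closure_sequential
    by (intro exI[of _ "\<lambda>n. c *\<^sub>C f n"])
      (auto intro: bounded_bilinear.tendsto[OF bounded_bilinear_scaleC] complex_vector.subspace_scale[OF M])
qed

lemma closure_span_subset_orth_compl:
  assumes "\<And>s. s \<in> S \<Longrightarrow> cinner s z = 0"
  shows "closure (complex_vector.span S) \<subseteq> orth_compl {z :: 'h::complex_hilbert}"
  by (intro closure_minimal complex_vector.span_minimal csubspace_orth_compl closed_orth_compl)
    (auto simp: orth_compl_def assms)

text \<open>Each new vector is chosen orthogonal to the finitely many earlier \<open>x j\<close> and
  to their images under \<open>adj T o\<^sub>L T\<close>; the latter makes the vectors
  \<open>T (x j)\<close> orthogonal.\<close>

lemma exists_orthogonal_sequence: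
  fixes T :: "'h::complex_hilbert \<Rightarrow>\<^sub>L 'h"
  assumes T: "T \<in> bounded_ops"
    and val: "\<And>n Y. finite Y \<Longrightarrow> \<exists>x\<in>orth_compl Y. norm x = 1 \<and> (norm (T x))\<^sup>2 = c (n::nat)"
  obtains x where "\<And>n. norm (x n) = 1" "\<And>n. (norm (blinfun_apply T (x n)))\<^sup>2 = c n"
    "\<And>m n. m \<noteq> n \<Longrightarrow> cinner (x m) (x n) = 0"
    "\<And>m n. m \<noteq> n \<Longrightarrow> cinner (T (x m)) (T (x n)) = 0"
proof -
  define P where "P f n r \<longleftrightarrow> r \<in> orth_compl (f ` {..<n} \<union> (\<lambda>j. adj T (T (f j))) ` {..<n})
    \<and> norm r = 1 \<and> (norm (T r))\<^sup>2 = c n" for f n r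
  have "\<exists>f. \<forall>n. P f n (f n)"
  proof (rule dependent_wellorder_choice)
    fix r :: 'h and f g :: "nat \<Rightarrow> 'h" and n
    assume "\<And>y. y < n \<Longrightarrow> f y = g y"
    then have "f ` {..<n} = g ` {..<n}" "(\<lambda>j. adj T (T (f j))) ` {..<n} = (\<lambda>j. adj T (T (g j))) ` {..<n}"
      by (auto intro!: image_cong)
    then show "P f n r = P g n r" by (simp only: P_def)
  next
    fix n f show "\<exists>r. P f n r"
      using val[of "f ` {..<n} \<union> (\<lambda>j. adj T (T (f j))) ` {..<n}" n] by (auto simp: P_def)
  qed
  then obtain x where x: "\<And>n. P x n (x n)" by blast
  have *: "cinner (x n) (x m) = 0 \<and> cinner (T (x n)) (T (x m)) = 0" if "m < n" for m n
  proof -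
    have "cinner (x n) (x m) = 0" "cinner (x n) (adj T (T (x m))) = 0"
      using x[of n] that by (auto simp: P_def orth_compl_def)
    then show ?thesis by (simp add: cinner_adj_right[OF T])
  qed
  have "cinner (x m) (x n) = 0 \<and> cinner (T (x m)) (T (x n)) = 0" if "m \<noteq> n" for m n
    using *[of m n] *[of n m] that by (metis cinner_eq_zero_commute linorder_neqE_nat)
  then show ?thesis using x that[of x] by (auto simp: P_def)
qed

text \<open>On the closed span of the sequence the form is strictly below \<open>b\<close>, which is its supremum.\<close>

lemma not_norm_attaining_on_closure_span:
  fixes T :: "'h::complex_hilbert \<Rightarrow>\<^sub>L 'h"
  assumes T: "T \<in> bounded_ops"
    and x: "\<And>n::nat. norm (x n) = 1" "\<And>n. (norm (T (x n)))\<^sup>2 = c n"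
    and orth: "\<And>m n. m \<noteq> n \<Longrightarrow> cinner (x m) (x n) = 0"
      "\<And>m n. m \<noteq> n \<Longrightarrow> cinner (T (x m)) (T (x n)) = 0"
    and c: "\<And>n. c n < b" "c \<longlonglongrightarrow> b"
  shows "\<not> norm_attaining_on (closure (complex_vector.span (range x))) T"
proof
  define M where "M = closure (complex_vector.span (range x))"
  have M: "complex_vector.subspace M"
    unfolding M_def by (intro csubspace_closure complex_vector.subspace_span)
  have xM: "x n \<in> M" for n
    unfolding M_def by (intro subsetD[OF closure_subset] complex_vector.span_base rangeI)
  \<comment> \<open>\<open>x n\<close> is an eigenvector, with eigenvalue \<open>c n\<close>, of the
    compression of \<open>adj T o\<^sub>L T\<close> to \<open>M\<close>: the error vector is
    orthogonal to all generators, hence to \<open>M\<close>.\<close>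
  have eigen: "cinner (T v) (T (x n)) = of_real (c n) * cinner v (x n)" if "v \<in> M" for v n
  proof -
    have "M \<subseteq> orth_compl {adj T (T (x n)) - c n *\<^sub>R x n}" unfolding M_def
    proof (rule closure_span_subset_orth_compl)
      fix s assume "s \<in> range x"
      then obtain m where "s = x m" by blast
      then show "cinner s (adj T (T (x n)) - c n *\<^sub>R x n) = 0"
        using orth[of m n] x
        by (cases "m = n") (auto simp: cinner_simps cinner_adj_right[OF T] cinner_self scaleR_conv_of_real)
    qed
    then show ?thesis using that
      by (auto simp: orth_compl_def cinner_simps cinner_adj_right[OF T] scaleR_conv_of_real)
  qed
  \<comment> \<open>By \<open>eigen\<close>, removing the component along \<open>x n\<close> lowers
    both squared norms without cross terms.\<close>
  have split: "(norm (T (v - k *\<^sub>C x n)))\<^sup>2 = (norm (T v))\<^sup>2 - c n * (cmod k)\<^sup>2"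
    "(norm (v - k *\<^sub>C x n))\<^sup>2 = (norm v)\<^sup>2 - (cmod k)\<^sup>2"
    if "v \<in> M" "k = cinner v (x n)" for v k n
  proof -
    have "cnj k * k = of_real ((cmod k)\<^sup>2)"
      by (simp add: complex_norm_square[symmetric] mult.commute flip: of_real_power)
    then have k: "Re (cnj k * k) = (cmod k)\<^sup>2" by (simp only: Re_complex_of_real)
    have "Re (cnj k * (of_real (c n) * k)) = Re (of_real (c n) * (cnj k * k))" by (simp only: mult.left_commute)
    also have "\<dots> = c n * Re (cnj k * k)" by simp
    finally have "Re (cnj k * (of_real (c n) * k)) = c n * (cmod k)\<^sup>2" unfolding k .
    then show "(norm (T (v - k *\<^sub>C x n)))\<^sup>2 = (norm (T v))\<^sup>2 - c n * (cmod k)\<^sup>2"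
      by (simp only: blinfun.diff_right bounded_ops_scaleC[OF T] power2_norm_diff cinner_scaleC_right
          eigen[OF that(1)] that(2)[symmetric] norm_scaleC power_mult_distrib x) simp
    show "(norm (v - k *\<^sub>C x n))\<^sup>2 = (norm v)\<^sup>2 - (cmod k)\<^sup>2"
      by (simp only: power2_norm_diff cinner_scaleC_right that(2)[symmetric] norm_scaleC power_mult_distrib x k) simp
  qed
  \<comment> \<open>The components are peeled off one at a time; each contributes at most
    \<open>b\<close> times its squared norm because \<open>c N < b\<close>.\<close>
  have span_le: "(norm (T v))\<^sup>2 \<le> b * (norm v)\<^sup>2" if "v \<in> complex_vector.span (x ` {..<N})" for v N
    using that
  proof (induction N arbitrary: v)
    case 0
    then show ?case by simp
  next
    case (Suc N)
    then obtain k where k: "v - k *\<^sub>C x N \<in> complex_vector.span (x ` {..<N})"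
      by (auto simp: lessThan_Suc complex_vector.span_breakdown_eq)
    have vM: "v \<in> M"
      unfolding M_def using Suc.prems complex_vector.span_mono[of "x ` {..<Suc N}" "range x"]
      by (intro subsetD[OF closure_subset]) auto
    have "closure (complex_vector.span (x ` {..<N})) \<subseteq> orth_compl {x N}"
      by (rule closure_span_subset_orth_compl) (auto intro: orth)
    then have "cinner (v - k *\<^sub>C x N) (x N) = 0"
      using subsetD[OF closure_subset k] by (auto simp: orth_compl_def)
    then have kN: "k = cinner v (x N)" by (simp add: cinner_simps cinner_self x)
    have "c N * (cmod k)\<^sup>2 \<le> b * (cmod k)\<^sup>2" using c(1)[of N] by (intro mult_right_mono) auto
    then show ?case using Suc.IH[OF k] split[OF vM kN] by (simp add: algebra_simps)
  qed
  have "complex_vector.span (range x) \<subseteq> {v. (norm (T v))\<^sup>2 \<le> b * (norm v)\<^sup>2}"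
  proof
    fix v assume "v \<in> complex_vector.span (range x)"
    then obtain t r where v: "v = (\<Sum>a\<in>t. r a *\<^sub>C a)" and t: "finite t" "t \<subseteq> range x"
      unfolding complex_vector.span_explicit by blast
    obtain N where "t \<subseteq> x ` {..<N}"
      using finite_subset_image[OF t] finite_nat_bounded by (metis image_mono)
    then have "v \<in> complex_vector.span (x ` {..<N})"
      unfolding v by (intro complex_vector.span_sum complex_vector.span_scale complex_vector.span_base) auto
    then show "v \<in> {v. (norm (T v))\<^sup>2 \<le> b * (norm v)\<^sup>2}" using span_le by blast
  qed
  then have M_le: "(norm (T v))\<^sup>2 \<le> b * (norm v)\<^sup>2" if "v \<in> M" for v
  proof -
    have "M \<subseteq> {v. (norm (T v))\<^sup>2 \<le> b * (norm v)\<^sup>2}"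
      unfolding M_def using \<open>complex_vector.span (range x) \<subseteq> _\<close>
      by (intro closure_minimal closed_Collect_le continuous_intros)
    then show ?thesis using that by blast
  qed
  assume "norm_attaining_on M T"
  then obtain z where z: "z \<in> M" "norm z = 1" "norm (T z) = norm_on M T"
    unfolding norm_attaining_on_def by blast
  have "c n \<le> (norm (T z))\<^sup>2" for n
    unfolding x(2)[symmetric] z(3) using xM x(1) by (intro power_mono norm_on_upper) auto
  then have Tz: "b \<le> (norm (T z))\<^sup>2" using LIMSEQ_le_const2[OF c(2)] by blast
  \<comment> \<open>A component along \<open>x n\<close> has ratio \<open>c n < b\<close>, so
    removing it from \<open>z\<close> would leave a vector violating \<open>M_le\<close>. Hence
    \<open>z\<close> is orthogonal to the generators and to \<open>M\<close>, itself
    included.\<close>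
  have "cinner (x n) z = 0" for n
  proof -
    define k where "k = cinner z (x n)"
    have "z - k *\<^sub>C x n \<in> M"
      using M z xM by (intro complex_vector.subspace_diff complex_vector.subspace_scale)
    from M_le[OF this] have "(b - c n) * (cmod k)\<^sup>2 \<le> 0"
      using split[OF z(1) k_def] Tz z(2) by (simp add: algebra_simps)
    then have "k = 0" using c(1)[of n] by (auto simp: mult_le_0_iff)
    then show ?thesis by (simp add: k_def cinner_eq_zero_commute)
  qed
  then have "M \<subseteq> orth_compl {z}" unfolding M_def by (intro closure_span_subset_orth_compl) auto
  then have "cinner z z = 0" using z(1) by (auto simp: orth_compl_def)
  then show False using z(2) by (simp add: cinner_eq_zero_iff)
qed

text \<open>A sequence of values tending to \<open>b\<close> from below is realised along a doubly
  orthogonal sequence, and the norm is not attained on its closed span.\<close>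

lemma not_AN_if_interval_of_values:
  fixes T :: "'h::complex_hilbert \<Rightarrow>\<^sub>L 'h"
  assumes T: "T \<in> bounded_ops" and "a < b"
    and val: "\<And>c Y. a < c \<Longrightarrow> c < b \<Longrightarrow> finite Y
      \<Longrightarrow> \<exists>x\<in>orth_compl Y. norm x = 1 \<and> (norm (T x))\<^sup>2 = c"
  shows "T \<notin> AN_ops"
proof
  assume AN: "T \<in> AN_ops"
  \<comment> \<open>The factor 1/2 keeps the first value \<open>c 0\<close> strictly above
    \<open>a\<close>.\<close>
  define d where "d n = (b - a) / 2 * (1 / real (Suc n))" for n
  define c where "c n = b - d n" for n
  have d_le: "d n \<le> (b - a) / 2 * 1" for n
    unfolding d_def using assms(2) by (intro mult_left_mono) auto
  have d_pos: "d n > 0" for n using assms(2) by (simp add: d_def)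
  have c: "a < c n" "c n < b" for n
    using assms(2) d_le[of n] d_pos[of n] by (simp_all add: c_def)
  have "d \<longlonglongrightarrow> 0"
    using tendsto_mult[OF tendsto_const[of "(b - a) / 2"] LIMSEQ_inverse_real_of_nat]
    unfolding d_def[abs_def] by (simp only: mult_zero_right inverse_eq_divide)
  from tendsto_diff[OF tendsto_const[of b] this] have lim: "c \<longlonglongrightarrow> b"
    unfolding c_def[abs_def] by (simp only: diff_zero)
  have val_c: "\<exists>x\<in>orth_compl Y. norm x = 1 \<and> (norm (T x))\<^sup>2 = c n" if "finite Y" for n Y
    by (rule val[OF c that])
  obtain x where x: "\<And>n. norm (x n) = 1" "\<And>n. (norm (blinfun_apply T (x n)))\<^sup>2 = c n"
    "\<And>m n. m \<noteq> n \<Longrightarrow> cinner (x m) (x n) = 0"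
    "\<And>m n. m \<noteq> n \<Longrightarrow> cinner (T (x m)) (T (x n)) = 0"
    by (rule exists_orthogonal_sequence[OF T, of c], erule val_c, rule that)
  let ?M = "closure (complex_vector.span (range x))"
  have "x 0 \<in> ?M" by (intro subsetD[OF closure_subset] complex_vector.span_base rangeI)
  moreover have "x 0 \<noteq> 0" using x(1)[of 0] by auto
  ultimately have "norm_attaining_on ?M T"
    using AN csubspace_closure[OF complex_vector.subspace_span] by (auto simp: AN_ops_def)
  then show False using not_norm_attaining_on_closure_span[OF T x c(2) lim] by blast
qed

text \<open>\<beta> is the infimum, over finite \<open>Y\<close>, of the supremum of the values on
  the unit sphere of \<open>orth_compl Y\<close>. It is obtained as the supremum of the numbers
  reached or exceeded on every such sphere.\<close>

lemma exists_essential_supremum: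
  fixes T :: "'h::complex_hilbert \<Rightarrow>\<^sub>L 'h"
  assumes unit: "\<And>Y :: 'h set. finite Y \<Longrightarrow> \<exists>x\<in>orth_compl Y. norm x = 1"
  obtains \<beta> where "\<And>e. e > 0 \<Longrightarrow> \<exists>Y. finite Y \<and> (\<forall>x\<in>orth_compl Y. norm x = 1 \<longrightarrow> (norm (T x))\<^sup>2 < \<beta> + e)"
    "\<And>e Y. e > 0 \<Longrightarrow> finite Y \<Longrightarrow> \<exists>x\<in>orth_compl Y. norm x = 1 \<and> (norm (T x))\<^sup>2 > \<beta> - e"
proof -
  define U where "U = {c. \<forall>Y. finite Y \<longrightarrow> (\<exists>x\<in>orth_compl Y. norm x = 1 \<and> c \<le> (norm (T x))\<^sup>2)}"
  have "0 \<in> U" using unit by (auto simp: U_def)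
  have bdd: "bdd_above U"
  proof (rule bdd_aboveI)
    fix c assume "c \<in> U"
    then obtain x where "norm x = 1" "c \<le> (norm (T x))\<^sup>2" unfolding U_def by blast
    moreover from this have "(norm (T x))\<^sup>2 \<le> (norm T)\<^sup>2"
      using norm_blinfun[of T x] by (intro power_mono) auto
    ultimately show "c \<le> (norm T)\<^sup>2" by linarith
  qed
  show ?thesis
  proof (rule that[of "Sup U"])
    fix e :: real assume e: "e > 0"
    have "Sup U + e \<notin> U" using cSup_upper[OF _ bdd, of "Sup U + e"] e by auto
    then show "\<exists>Y. finite Y \<and> (\<forall>x\<in>orth_compl Y. norm x = 1 \<longrightarrow> (norm (T x))\<^sup>2 < Sup U + e)"
      unfolding U_def by (simp add: not_le)
  next
    fix e :: real and Y :: "'h set" assume e: "e > 0" and Y: "finite Y"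
    obtain c where "c \<in> U" "Sup U - e < c"
      using less_cSup_iff[OF _ bdd, of "Sup U - e"] \<open>0 \<in> U\<close> e by auto
    moreover from this obtain x where "x \<in> orth_compl Y" "norm x = 1" "c \<le> (norm (T x))\<^sup>2"
      using Y unfolding U_def by blast
    ultimately show "\<exists>x\<in>orth_compl Y. norm x = 1 \<and> (norm (T x))\<^sup>2 > Sup U - e"
      by (intro bexI[of _ x]) auto
  qed
qed

text \<open>Expresses compactness of \<open>adj T o\<^sub>L T\<close> minus \<alpha> through values
  at unit vectors only, a form that is easy to carry to norm limits.\<close>

definition essentially_const :: "('h::complex_hilbert \<Rightarrow>\<^sub>L 'h) \<Rightarrow> real \<Rightarrow> bool" where
  "essentially_const T \<alpha> \<longleftrightarrow> (\<forall>e>0. \<exists>Y. finite Y \<and>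
     (\<forall>x\<in>orth_compl Y. norm x = 1 \<longrightarrow> \<bar>(norm (T x))\<^sup>2 - \<alpha>\<bar> \<le> e))"

text \<open>For unit vectors \<open>u\<close> and \<open>w\<close> that are orthogonal in both
  forms, the value at a normalised combination is a convex combination of their values, so suitable
  weights hit \<open>c\<close> exactly.\<close>

lemma interpolate_value:
  fixes T :: "'h::complex_hilbert \<Rightarrow>\<^sub>L 'h"
  assumes T: "T \<in> bounded_ops" and Y: "finite Y"
    and up: "\<And>Y. finite Y \<Longrightarrow> \<exists>x\<in>orth_compl Y. norm x = 1 \<and> (norm (T x))\<^sup>2 > c"
    and low: "\<And>Y. finite Y \<Longrightarrow> \<exists>x\<in>orth_compl Y. norm x = 1 \<and> (norm (T x))\<^sup>2 < c"
  shows "\<exists>x\<in>orth_compl Y. norm x = 1 \<and> (norm (T x))\<^sup>2 = c"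
proof -
  obtain u where u: "u \<in> orth_compl Y" "norm u = 1" "(norm (T u))\<^sup>2 > c" using up[OF Y] by blast
  \<comment> \<open>The extra vector \<open>adj T (T u)\<close> makes \<open>T w\<close> orthogonal
    to \<open>T u\<close>.\<close>
  obtain w where w: "w \<in> orth_compl (Y \<union> {u, adj T (T u)})" "norm w = 1" "(norm (T w))\<^sup>2 < c"
    using low[of "Y \<union> {u, adj T (T u)}"] Y by auto
  define p where "p = (norm (T u))\<^sup>2"
  define q where "q = (norm (T w))\<^sup>2"
  \<comment> \<open>\<open>s\<close> and \<open>t\<close> solve
    \<open>t\<^sup>2 + s\<^sup>2 = 1\<close> and
    \<open>t\<^sup>2 * q + s\<^sup>2 * p = c\<close>.\<close>
  define s where "s = sqrt ((c - q) / (p - q))"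
  define t where "t = sqrt ((p - c) / (p - q))"
  have pcq: "q < c" "c < p" using u w by (simp_all add: p_def q_def)
  then have st: "s\<^sup>2 = (c - q) / (p - q)" "t\<^sup>2 = (p - c) / (p - q)"
    by (auto simp: s_def t_def intro!: divide_nonneg_nonneg)
  have pq: "p - q \<noteq> 0" using pcq by simp
  have orth: "cinner w u = 0" "cinner (T w) (T u) = 0"
    using w(1) by (auto simp: orth_compl_def cinner_adj_right[OF T])
  have "(norm (t *\<^sub>R w + s *\<^sub>R u))\<^sup>2 = t\<^sup>2 + s\<^sup>2"
    by (simp add: power2_norm_add cinner_simps orth u w)
  also have "\<dots> = 1" using pq by (simp add: st flip: add_divide_distrib)
  finally have "norm (t *\<^sub>R w + s *\<^sub>R u) = 1" 
    using power2_eq_iff_nonneg[of "norm (t *\<^sub>R w + s *\<^sub>R u)" 1] by simp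
  moreover have "(norm (T (t *\<^sub>R w + s *\<^sub>R u)))\<^sup>2 = t\<^sup>2 * q + s\<^sup>2 * p"
    by (simp add: blinfun.bilinear_simps power2_norm_add cinner_simps orth p_def q_def power_mult_distrib)
  moreover have "t\<^sup>2 * q + s\<^sup>2 * p = c * (p - q) / (p - q)"
    by (simp add: st algebra_simps flip: add_divide_distrib)
  then have "t\<^sup>2 * q + s\<^sup>2 * p = c" using pq by simp
  moreover have "t *\<^sub>R w + s *\<^sub>R u \<in> orth_compl Y"
    using u(1) w(1) csubspace_orth_compl[of Y]
    by (intro complex_vector.subspace_add csubspace_scaleR) (auto simp: orth_compl_def)
  ultimately show ?thesis by metis
qed

text \<open>\<alpha> is the essential supremum \<beta>. If values below \<open>\<beta> - e\<close>
  occurred in every cofinite subspace, interpolation with values near \<beta> would fill the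
  interval between them, which contradicts absolute norm attainment.\<close>

lemma AN_imp_essentially_const:
  fixes T :: "'h::complex_hilbert \<Rightarrow>\<^sub>L 'h"
  assumes AN: "T \<in> AN_ops"
  shows "\<exists>\<alpha>. essentially_const T \<alpha>"
proof (cases "\<forall>Y :: 'h set. finite Y \<longrightarrow> (\<exists>x\<in>orth_compl Y. norm x = 1)")
  \<comment> \<open>Some finite \<open>Y\<close> leaves no unit vector in
    \<open>orth_compl Y\<close>, and with it the condition holds vacuously for every number.\<close>
  case False
  then show ?thesis by (auto simp: essentially_const_def)
next
  case True
  have T: "T \<in> bounded_ops" using AN by (simp add: AN_ops_def)
  obtain \<beta> where up: "\<And>e. e > 0 \<Longrightarrow> \<exists>Y. finite Y \<and> (\<forall>x\<in>orth_compl Y. norm x = 1 \<longrightarrow> (norm (T x))\<^sup>2 < \<beta> + e)"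
    and val: "\<And>e Y. e > 0 \<Longrightarrow> finite Y \<Longrightarrow> \<exists>x\<in>orth_compl Y. norm x = 1 \<and> (norm (T x))\<^sup>2 > \<beta> - e"
    using exists_essential_supremum[of T] True by blast
  have "essentially_const T \<beta>" unfolding essentially_const_def
  proof (intro allI impI)
    fix e :: real assume e: "e > 0"
    have "\<exists>Y. finite Y \<and> (\<forall>x\<in>orth_compl Y. norm x = 1 \<longrightarrow> (norm (T x))\<^sup>2 \<ge> \<beta> - e)"
    proof (rule ccontr)
      assume neg: "\<not> ?thesis"
      have "T \<notin> AN_ops"
      proof (rule not_AN_if_interval_of_values[OF T, of "\<beta> - e" \<beta>])
        fix c and Y :: "'h set" assume c: "\<beta> - e < c" "c < \<beta>" and Y: "finite Y"
        show "\<exists>x\<in>orth_compl Y. norm x = 1 \<and> (norm (T x))\<^sup>2 = c"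
        proof (rule interpolate_value[OF T Y])
          fix Z :: "'h set" assume Z: "finite Z"
          show "\<exists>x\<in>orth_compl Z. norm x = 1 \<and> (norm (T x))\<^sup>2 > c"
            using val[of "\<beta> - c" Z] c Z by auto
          show "\<exists>x\<in>orth_compl Z. norm x = 1 \<and> (norm (T x))\<^sup>2 < c"
            using neg Z c(1) by (meson less_trans not_le)
        qed
      qed (use e in simp)
      then show False using AN by blast
    qed
    then obtain Y2 where Y2: "finite Y2" "\<And>x. x \<in> orth_compl Y2 \<Longrightarrow> norm x = 1 \<Longrightarrow> (norm (T x))\<^sup>2 \<ge> \<beta> - e"
      by blast
    obtain Y1 where Y1: "finite Y1" "\<And>x. x \<in> orth_compl Y1 \<Longrightarrow> norm x = 1 \<Longrightarrow> (norm (T x))\<^sup>2 < \<beta> + e"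
      using up[OF e] by blast
    have "\<bar>(norm (T x))\<^sup>2 - \<beta>\<bar> \<le> e" if "x \<in> orth_compl (Y1 \<union> Y2)" "norm x = 1" for x
      using Y1(2)[of x] Y2(2)[of x] that by (auto simp: orth_compl_Un)
    then show "\<exists>Y. finite Y \<and> (\<forall>x\<in>orth_compl Y. norm x = 1 \<longrightarrow> \<bar>(norm (T x))\<^sup>2 - \<beta>\<bar> \<le> e)"
      using Y1(1) Y2(1) by (intro exI[of _ "Y1 \<union> Y2"]) auto
  qed
  then show ?thesis by blast
qed

text \<open>The constant is fixed in advance as the essential supremum \<beta> of \<open>T\<close>,
  so no limit of constants is taken. A nearby \<open>S\<close> bounds the oscillation of the values
  of \<open>T\<close> on a cofinite subspace, and one value near \<beta> there places the
  others.\<close>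

lemma closure_AN_imp_essentially_const:
  fixes T :: "'h::complex_hilbert \<Rightarrow>\<^sub>L 'h"
  assumes cl: "T \<in> closure AN_ops"
  shows "\<exists>\<alpha>. essentially_const T \<alpha>"
proof (cases "\<forall>Y :: 'h set. finite Y \<longrightarrow> (\<exists>x\<in>orth_compl Y. norm x = 1)")
  case False
  then show ?thesis by (auto simp: essentially_const_def)
next
  case True
  obtain \<beta> where up: "\<And>e. e > 0 \<Longrightarrow> \<exists>Y. finite Y \<and> (\<forall>x\<in>orth_compl Y. norm x = 1 \<longrightarrow> (norm (T x))\<^sup>2 < \<beta> + e)"
    and val: "\<And>e Y. e > 0 \<Longrightarrow> finite Y \<Longrightarrow> \<exists>x\<in>orth_compl Y. norm x = 1 \<and> (norm (T x))\<^sup>2 > \<beta> - e"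
    using exists_essential_supremum[of T] True by blast
  have "essentially_const T \<beta>" unfolding essentially_const_def
  proof (intro allI impI)
    fix e :: real assume e: "e > 0"
    \<comment> \<open>The squares differ by at most \<open>d\<close> times the sum of the norms, and
      \<open>d \<le> 1\<close> bounds that sum by \<open>2 * norm T + 1\<close>.\<close>
    define d where "d = min 1 (e / (4 * (2 * norm T + 1)))"
    have nT: "2 * norm T + 1 > 0" using norm_ge_zero[of T] by linarith
    then have "0 < e / (4 * (2 * norm T + 1))" using e by simp
    then have d: "0 < d" "d \<le> 1" "d \<le> e / (4 * (2 * norm T + 1))"
      by (simp_all only: d_def min.cobounded1 min.cobounded2 min_less_iff_conj) simp
    obtain S where S: "S \<in> AN_ops" "dist S T < d" using cl d(1) unfolding closure_approachable by blast
    have close: "\<bar>(norm (S x))\<^sup>2 - (norm (T x))\<^sup>2\<bar> \<le> e / 4" if "norm x = 1" for x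
    proof -
      have "\<bar>norm (S x) - norm (T x)\<bar> \<le> norm (S x - T x)" by (rule norm_triangle_ineq3)
      also have "\<dots> = norm ((S - T) x)" by (simp add: blinfun.diff_left)
      also have "\<dots> \<le> d" using norm_blinfun[of "S - T" x] that S(2) by (simp add: dist_norm)
      finally have 1: "\<bar>norm (S x) - norm (T x)\<bar> \<le> d" .
      have "norm (T x) \<le> norm T" using norm_blinfun[of T x] that by simp
      then have 2: "norm (S x) + norm (T x) \<le> 2 * norm T + 1" using 1 d(2) by linarith
      have "\<bar>(norm (S x))\<^sup>2 - (norm (T x))\<^sup>2\<bar> = \<bar>norm (S x) - norm (T x)\<bar> * (norm (S x) + norm (T x))"
        by (simp add: power2_eq_square square_diff_square_factored abs_mult)
      also have "\<dots> \<le> (e / (4 * (2 * norm T + 1))) * (2 * norm T + 1)"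
        using 1 2 d(3) e by (intro mult_mono) auto
      also have "\<dots> = e / 4" using nT by (simp add: field_simps)
      finally show ?thesis .
    qed
    obtain \<alpha> where "essentially_const S \<alpha>" using AN_imp_essentially_const[OF S(1)] by blast
    then obtain Y2 where Y2: "finite Y2" "\<And>x. x \<in> orth_compl Y2 \<Longrightarrow> norm x = 1 \<Longrightarrow> \<bar>(norm (S x))\<^sup>2 - \<alpha>\<bar> \<le> e / 8"
      using e unfolding essentially_const_def by (metis zero_less_divide_iff zero_less_numeral)
    obtain Y1 where Y1: "finite Y1" "\<And>x. x \<in> orth_compl Y1 \<Longrightarrow> norm x = 1 \<Longrightarrow> (norm (T x))\<^sup>2 < \<beta> + e"
      using up[OF e] by blast
    obtain y where y: "y \<in> orth_compl Y2" "norm y = 1" "(norm (T y))\<^sup>2 > \<beta> - e / 4"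
      using val[of "e / 4", OF _ Y2(1)] e by auto
    \<comment> \<open>Lower bound through \<open>y\<close>: \<open>e/4\<close> for its value,
      \<open>e/4\<close> twice for passing between \<open>T\<close> and \<open>S\<close>, and
      \<open>e/8\<close> twice for the oscillation of \<open>S\<close>.\<close>
    have "\<bar>(norm (T x))\<^sup>2 - \<beta>\<bar> \<le> e" if "x \<in> orth_compl (Y1 \<union> Y2)" "norm x = 1" for x
    proof -
      have x: "x \<in> orth_compl Y1" "x \<in> orth_compl Y2" using that by (auto simp: orth_compl_Un)
      show ?thesis
        using Y1(2)[OF x(1) that(2)] Y2(2)[OF x(2) that(2)] Y2(2)[OF y(1,2)]
          close[OF that(2)] close[OF y(2)] y(3) by linarith
    qed
    then show "\<exists>Y. finite Y \<and> (\<forall>x\<in>orth_compl Y. norm x = 1 \<longrightarrow> \<bar>(norm (T x))\<^sup>2 - \<beta>\<bar> \<le> e)"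
      using Y1(1) Y2(1) by (intro exI[of _ "Y1 \<union> Y2"]) auto
  qed
  then show ?thesis by blast
qed

text \<open>Polarisation at \<open>x\<close> and the unit vector in the direction of
  \<open>S x\<close>, followed by the parallelogram law, turns the bound on the form into one on the
  norm.\<close>

lemma norm_selfadjoint_le:
  fixes S :: "'h::complex_hilbert \<Rightarrow>\<^sub>L 'h"
  assumes S: "S \<in> bounded_ops" "adj S = S"
    and e: "e \<ge> 0" and q: "\<And>x. \<bar>Re (cinner (S x) x)\<bar> \<le> e * (norm x)\<^sup>2"
  shows "norm S \<le> e"
proof (rule norm_blinfun_le_if_unit)
  fix x :: 'h assume x: "norm x \<le> 1"
  show "norm (S x) \<le> e"
  proof (cases "S x = 0")
    case True
    then show ?thesis using e by simp
  next
    case False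
    define y where "y = (1 / norm (S x)) *\<^sub>R S x"
    have y: "norm y = 1" using False by (simp add: y_def)
    have sym: "Re (cinner (S y) x) = Re (cinner (S x) y)"
      using S adj_eq_self_iff[OF S(1)] Re_cinner_commute by metis
    have "norm (S x) = Re (cinner (S x) y)"
      using False by (simp add: y_def cinner_simps Re_cinner_self power2_eq_square)
    then have "4 * norm (S x) = Re (cinner (S (x + y)) (x + y)) - Re (cinner (S (x - y)) (x - y))"
      using sym by (simp add: blinfun.bilinear_simps cinner_simps)
    also have "\<dots> \<le> e * (norm (x + y))\<^sup>2 + e * (norm (x - y))\<^sup>2"
      using q[of "x + y"] q[of "x - y"] by linarith
    also have "\<dots> = e * (2 * (norm x)\<^sup>2 + 2)"
      using norm_parallelogram[of x y] y by (simp flip: distrib_left)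
    also have "\<dots> \<le> e * 4" using e x by (intro mult_left_mono) (auto simp: power_le_one)
    finally show ?thesis by simp
  qed
qed

text \<open>The compression of \<open>B\<close> to a cofinite subspace is self-adjoint with a small
  form, hence of small norm, and it differs from \<open>B\<close> by a compact operator. So
  \<open>B\<close> is a limit of compact operators.\<close>

lemma essentially_const_imp_compact:
  fixes T :: "'h::complex_hilbert \<Rightarrow>\<^sub>L 'h"
  assumes T: "T \<in> bounded_ops" and ess: "essentially_const T \<alpha>"
  shows "(adj T o\<^sub>L T) - \<alpha> *\<^sub>R id_blinfun \<in> compact_ops"
proof -
  define B where "B = (adj T o\<^sub>L T) - \<alpha> *\<^sub>R id_blinfun"
  have B: "B \<in> bounded_ops" "adj B = B"
    using T by (auto simp: B_def adj_diff adj_compose_self adj_scaleR)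
  have form: "Re (cinner (B x) x) = (norm (T x))\<^sup>2 - \<alpha> * (norm x)\<^sup>2" for x
    by (simp add: B_def blinfun.bilinear_simps cinner_simps cinner_adj_left[OF T] Re_cinner_self)
  have "\<exists>K\<in>compact_ops. dist K B < e" if e: "e > 0" for e
  proof -
    obtain Y where Y: "finite Y" "\<And>x. x \<in> orth_compl Y \<Longrightarrow> norm x = 1 \<Longrightarrow> \<bar>(norm (T x))\<^sup>2 - \<alpha>\<bar> \<le> e / 2"
      using ess e unfolding essentially_const_def by (metis half_gt_zero)
    have Y_le: "\<bar>Re (cinner (B x) x)\<bar> \<le> e / 2 * (norm x)\<^sup>2" if x: "x \<in> orth_compl Y" for x
    proof (cases "x = 0")
      case False
      have "\<bar>(norm (T ((1 / norm x) *\<^sub>R x)))\<^sup>2 - \<alpha>\<bar> \<le> e / 2"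
        using False x by (intro Y(2) csubspace_scaleR[OF csubspace_orth_compl]) auto
      moreover have "(norm (T ((1 / norm x) *\<^sub>R x)))\<^sup>2 - \<alpha> = ((norm (T x))\<^sup>2 - \<alpha> * (norm x)\<^sup>2) / (norm x)\<^sup>2"
        using False by (simp add: blinfun.scaleR_right power_divide field_simps)
      ultimately show ?thesis using False by (simp add: form abs_divide divide_simps)
    qed simp
    obtain Q where Q: "Q \<in> bounded_ops" "adj Q = Q" "norm Q \<le> 1" "\<And>x. blinfun_apply Q x \<in> orth_compl Y"
      and P: "id_blinfun - Q \<in> compact_ops"
      using exists_cofinite_projection[OF Y(1)] by metis
    define S where "S = Q o\<^sub>L B o\<^sub>L Q"
    have "norm S \<le> e / 2"
    proof (rule norm_selfadjoint_le)
      show "0 \<le> e / 2" using e by simp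
      show "S \<in> bounded_ops" "adj S = S"
        unfolding S_def using Q B by (simp_all add: adj_compose blinfun_compose_assoc)
      fix x
      have "cinner (S x) x = cinner (B (Q x)) (Q x)"
        using Q(2) adj_eq_self_iff[OF Q(1)] by (simp add: S_def)
      then have "\<bar>Re (cinner (S x) x)\<bar> \<le> e / 2 * (norm (Q x))\<^sup>2" using Y_le[OF Q(4)] by simp
      also have "norm (Q x) \<le> norm Q * norm x" by (rule norm_blinfun)
      then have "norm (Q x) \<le> norm x"
        using Q(3) mult_right_mono[of "norm Q" 1 "norm x"] by simp
      then have "e / 2 * (norm (Q x))\<^sup>2 \<le> e / 2 * (norm x)\<^sup>2"
        using e by (intro mult_left_mono power_mono) auto
      finally show "\<bar>Re (cinner (S x) x)\<bar> \<le> e / 2 * (norm x)\<^sup>2" .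
    qed
    moreover have "B - S = ((id_blinfun - Q) o\<^sub>L B) + (Q o\<^sub>L B o\<^sub>L (id_blinfun - Q))"
      unfolding S_def by (rule blinfun_eqI) (simp add: blinfun.bilinear_simps)
    then have "B - S \<in> compact_ops"
      by (simp only:) (intro compact_ops_add compact_ops_compose_right[OF P] compact_ops_compose_left[OF P]
          bounded_ops_closed Q B)
    ultimately show ?thesis using e by (intro bexI[of _ "B - S"]) (auto simp: dist_norm)
  qed
  then have "B \<in> closure compact_ops" by (simp add: closure_approachable)
  then show ?thesis by (simp only: B_def closure_closed[OF closed_compact_ops])
qed


section \<open>The essential spectrum\<close>

lemma calkin_proj_eq_image: "calkin_proj A = (\<lambda>K. K + A) ` compact_ops"
  by (auto simp: calkin_proj_def a_r_coset_def r_coset_def op_ring_def)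

lemma calkin_proj_eq_iff:
  fixes A B :: "'h::complex_hilbert \<Rightarrow>\<^sub>L 'h"
  shows "calkin_proj A = calkin_proj B \<longleftrightarrow> A - B \<in> compact_ops"
proof
  assume eq: "calkin_proj A = calkin_proj B"
  have "0 + A \<in> calkin_proj A" unfolding calkin_proj_eq_image by (rule imageI) (rule compact_ops_zero)
  then have "A \<in> (\<lambda>K. K + B) ` compact_ops" unfolding eq by (simp only: calkin_proj_eq_image add_0)
  then obtain K where "K \<in> compact_ops" "A = K + B" by blast
  then show "A - B \<in> compact_ops" by simp
next
  have sub: "calkin_proj A \<subseteq> calkin_proj B" if "A - B \<in> compact_ops" for A B :: "'h \<Rightarrow>\<^sub>L 'h"
  proof
    fix C assume "C \<in> calkin_proj A"
    then obtain K where K: "K \<in> compact_ops" "C = K + A" unfolding calkin_proj_eq_image by auto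
    then have "C = (K + (A - B)) + B" by simp
    then show "C \<in> calkin_proj B"
      unfolding calkin_proj_eq_image using compact_ops_add[OF K(1) that] by (rule image_eqI)
  qed
  assume *: "A - B \<in> compact_ops"
  then have "B - A \<in> compact_ops" using compact_ops_scaleR[of "A - B" "-1"] by simp
  then show "calkin_proj A = calkin_proj B" using sub[OF *] sub by blast
qed

lemma carrier_calkin: "carrier calkin = calkin_proj ` bounded_ops"
  by (auto simp: calkin_def FactRing_def A_RCOSETS_def RCOSETS_def op_ring_def calkin_proj_def a_r_coset_def)

lemma ring_hom_calkin_proj: "ring_hom_ring op_ring calkin calkin_proj"
  using ideal.rcos_ring_hom_ring[OF ideal_compact_ops]
  by (simp add: calkin_def calkin_proj_def[abs_def])

text \<open>Translates invertibility of a coset into the existence of a two-sided inverse modulo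
  compact operators, with which one can calculate.\<close>

lemma calkin_proj_in_Units_iff:
  assumes A: "A \<in> bounded_ops"
  shows "calkin_proj A \<in> Units calkin \<longleftrightarrow>
    (\<exists>B\<in>bounded_ops. (B o\<^sub>L A) - id_blinfun \<in> compact_ops \<and> (A o\<^sub>L B) - id_blinfun \<in> compact_ops)"
proof -
  interpret h: ring_hom_ring op_ring calkin "calkin_proj :: ('a \<Rightarrow>\<^sub>L 'a) \<Rightarrow> _"
    by (rule ring_hom_calkin_proj)
  have mult: "calkin_proj C \<otimes>\<^bsub>calkin\<^esub> calkin_proj D = calkin_proj (C o\<^sub>L D)"
    if "C \<in> bounded_ops" "D \<in> bounded_ops" for C D :: "'a \<Rightarrow>\<^sub>L 'a"
    using h.hom_mult[of C D] that by (simp add: op_ring_def)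
  have one: "\<one>\<^bsub>calkin\<^esub> = calkin_proj (id_blinfun :: 'a \<Rightarrow>\<^sub>L 'a)"
    using h.hom_one by (simp add: op_ring_def)
  show ?thesis
    using A by (auto simp: Units_def carrier_calkin mult one calkin_proj_eq_iff)
qed

text \<open>The point 0 is where equality of essential spectra is exploited: it transfers
  invertibility modulo compact operators from one product to the other.\<close>

lemma zero_in_ess_spectrum_iff:
  assumes A: "A \<in> bounded_ops"
  shows "0 \<in> ess_spectrum A \<longleftrightarrow> \<not> (\<exists>B\<in>bounded_ops.
    (B o\<^sub>L A) - id_blinfun \<in> compact_ops \<and> (A o\<^sub>L B) - id_blinfun \<in> compact_ops)"
proof -
  interpret h: ring_hom_ring op_ring calkin "calkin_proj :: ('a \<Rightarrow>\<^sub>L 'a) \<Rightarrow> _"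
    by (rule ring_hom_calkin_proj)
  have "scalar_op 0 = (0 :: 'a \<Rightarrow>\<^sub>L 'a)"
    by (rule blinfun_eqI) (simp add: scalar_op.rep_eq)
  then have "calkin_proj (scalar_op 0 :: 'a \<Rightarrow>\<^sub>L 'a) = \<zero>\<^bsub>calkin\<^esub>"
    using h.hom_zero by (simp add: op_ring_def)
  moreover have "calkin_proj A \<in> carrier calkin" using A by (simp add: carrier_calkin)
  ultimately have "calkin_proj A \<ominus>\<^bsub>calkin\<^esub> calkin_proj (scalar_op 0) = calkin_proj A"
    by (simp add: a_minus_def)
  then show ?thesis
    by (simp add: ess_spectrum_def spectrum_def calkin_proj_in_Units_iff[OF A])
qed

lemma ess_spectrum_cong: "A - B \<in> compact_ops \<Longrightarrow> ess_spectrum A = ess_spectrum B"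
  by (simp add: ess_spectrum_def calkin_proj_eq_iff[symmetric])

section \<open>The three implications\<close>

lemma closure_AN_iff:
  assumes T: "T \<in> bounded_ops"
  shows "T \<in> closure AN_ops \<longleftrightarrow> (\<exists>\<alpha>. (adj T o\<^sub>L T) - \<alpha> *\<^sub>R id_blinfun \<in> compact_ops)"
  using T closure_AN_opsI closure_AN_imp_essentially_const essentially_const_imp_compact by blast

text \<open>Modulo compact operators, \<open>T o\<^sub>L adj T o\<^sub>L T\<close> is both \<alpha>
  and \<beta> times \<open>T\<close>. So either \<alpha> = \<beta> or \<open>T\<close> is compact,
  and in both cases the two products agree modulo compact operators.\<close>

lemma ess_spectrum_eq_if_closure_AN:
  fixes T :: "'h::complex_hilbert \<Rightarrow>\<^sub>L 'h"
  assumes T: "T \<in> bounded_ops" and AN: "T \<in> closure AN_ops" "adj T \<in> closure AN_ops"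
  shows "ess_spectrum (adj T o\<^sub>L T) = ess_spectrum (T o\<^sub>L adj T)"
proof (rule ess_spectrum_cong)
  obtain \<alpha> where \<alpha>: "(adj T o\<^sub>L T) - \<alpha> *\<^sub>R id_blinfun \<in> compact_ops"
    using AN(1) closure_AN_iff[OF T] by blast
  obtain \<beta> where \<beta>: "(T o\<^sub>L adj T) - \<beta> *\<^sub>R id_blinfun \<in> compact_ops"
    using AN(2) closure_AN_iff[of "adj T"] T by (auto simp: adj_adj)
  have "(((T o\<^sub>L adj T) - \<beta> *\<^sub>R id_blinfun) o\<^sub>L T) - (T o\<^sub>L ((adj T o\<^sub>L T) - \<alpha> *\<^sub>R id_blinfun)) \<in> compact_ops"
    by (rule compact_ops_diff[OF compact_ops_compose_right[OF \<beta> T] compact_ops_compose_left[OF \<alpha> T]])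
  also have "(((T o\<^sub>L adj T) - \<beta> *\<^sub>R id_blinfun) o\<^sub>L T) - (T o\<^sub>L ((adj T o\<^sub>L T) - \<alpha> *\<^sub>R id_blinfun))
      = (\<alpha> - \<beta>) *\<^sub>R T"
    by (rule blinfun_eqI) (simp add: blinfun.bilinear_simps algebra_simps)
  finally have c: "(\<alpha> - \<beta>) *\<^sub>R T \<in> compact_ops" .
  show "(adj T o\<^sub>L T) - (T o\<^sub>L adj T) \<in> compact_ops"
  proof (cases "\<alpha> = \<beta>")
    case True
    then show ?thesis using compact_ops_diff[OF \<alpha> \<beta>] by simp
  next
    case False
    then have "T \<in> compact_ops" using compact_ops_scaleR[OF c, of "1 / (\<alpha> - \<beta>)"] by simp
    then show ?thesis
      using T by (simp add: compact_ops_diff compact_ops_compose_left compact_ops_compose_right)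
  qed
qed

text \<open>If \<open>\<alpha> \<noteq> 0\<close>, then \<open>T T\<^sup>*\<close> is invertible modulo compact operators along with \<open>T\<^sup>* T\<close>, and
  \<open>T T\<^sup>* (T T\<^sup>* - \<alpha>) = T (T\<^sup>* T - \<alpha>) T\<^sup>*\<close> is compact.\<close>

lemma adj_in_closure_AN:
  fixes T :: "'h::complex_hilbert \<Rightarrow>\<^sub>L 'h"
  assumes T: "T \<in> bounded_ops" and AN: "T \<in> closure AN_ops"
    and ess: "ess_spectrum (adj T o\<^sub>L T) = ess_spectrum (T o\<^sub>L adj T)"
  shows "adj T \<in> closure AN_ops"
proof -
  let ?A = "adj T o\<^sub>L T" and ?D = "T o\<^sub>L adj T"
  have A: "?A \<in> bounded_ops" and D: "?D \<in> bounded_ops" using T by simp_all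
  obtain \<alpha> where \<alpha>: "?A - \<alpha> *\<^sub>R id_blinfun \<in> compact_ops"
    using AN closure_AN_iff[OF T] by blast
  have "?D - \<alpha> *\<^sub>R id_blinfun \<in> compact_ops"
  proof (cases "\<alpha> = 0")
    case True
    then have "T \<in> compact_ops" using \<alpha> T compact_ops_if_adj_compose by auto
    then show ?thesis using True T by (simp add: compact_ops_compose_right)
  next
    case False
    \<comment> \<open>\<open>B\<close> inverts \<open>adj T o\<^sub>L T\<close> modulo compact
      operators, so 0 lies in neither essential spectrum.\<close>
    define B where "B = (1 / \<alpha>) *\<^sub>R (id_blinfun :: 'h \<Rightarrow>\<^sub>L 'h)"
    have "(B o\<^sub>L ?A) - id_blinfun = (1 / \<alpha>) *\<^sub>R (?A - \<alpha> *\<^sub>R id_blinfun)"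
      "(?A o\<^sub>L B) - id_blinfun = (1 / \<alpha>) *\<^sub>R (?A - \<alpha> *\<^sub>R id_blinfun)"
      unfolding B_def using False
      by (auto intro!: blinfun_eqI simp: blinfun.bilinear_simps algebra_simps)
    then have "0 \<notin> ess_spectrum ?A"
      unfolding zero_in_ess_spectrum_iff[OF A] using compact_ops_scaleR[OF \<alpha>, of "1 / \<alpha>"]
      by (auto simp: B_def intro!: bexI[of _ B])
    then obtain C where C: "C \<in> bounded_ops" "(C o\<^sub>L ?D) - id_blinfun \<in> compact_ops"
      unfolding ess zero_in_ess_spectrum_iff[OF D] by blast
    let ?E = "?D - \<alpha> *\<^sub>R id_blinfun"
    \<comment> \<open>The left inverse \<open>C\<close> of \<open>?D\<close> modulo compact
      operators cancels \<open>?D\<close> in the compact product \<open>?D o\<^sub>L ?E\<close>,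
      which leaves \<open>?E\<close> up to a compact error.\<close>
    have "(C o\<^sub>L (T o\<^sub>L (?A - \<alpha> *\<^sub>R id_blinfun) o\<^sub>L adj T)) - (((C o\<^sub>L ?D) - id_blinfun) o\<^sub>L ?E) \<in> compact_ops"
      using T C(1) compact_ops_compose_left[OF \<alpha> T] compact_ops_compose_right[OF C(2)]
      by (simp add: compact_ops_diff compact_ops_compose_left compact_ops_compose_right)
    also have "(C o\<^sub>L (T o\<^sub>L (?A - \<alpha> *\<^sub>R id_blinfun) o\<^sub>L adj T)) - (((C o\<^sub>L ?D) - id_blinfun) o\<^sub>L ?E) = ?E"
      by (rule blinfun_eqI) (simp add: blinfun.bilinear_simps algebra_simps)
    finally show ?thesis .
  qed
  then have "(adj (adj T) o\<^sub>L adj T) - \<alpha> *\<^sub>R id_blinfun \<in> compact_ops" using T by (simp add: adj_adj)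
  then show ?thesis using T by (intro closure_AN_opsI) auto
qed

text \<open>The last implication is the second one applied to \<open>adj T\<close>, because
  \<open>adj (adj T) = T\<close> exchanges the two products.\<close>

theorem theorem4p12:
  fixes T :: "'h::complex_hilbert \<Rightarrow>\<^sub>L 'h"
  assumes "infinite_dimensional TYPE('h)"
    and "T \<in> bounded_ops"
  shows "(T \<in> closure AN_ops \<and> adj T \<in> closure AN_ops
            \<longrightarrow> ess_spectrum (adj T o\<^sub>L T) = ess_spectrum (T o\<^sub>L adj T))
       \<and> (T \<in> closure AN_ops \<and> ess_spectrum (adj T o\<^sub>L T) = ess_spectrum (T o\<^sub>L adj T)
            \<longrightarrow> adj T \<in> closure AN_ops)
       \<and> (adj T \<in> closure AN_ops \<and> ess_spectrum (adj T o\<^sub>L T) = ess_spectrum (T o\<^sub>L adj T)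
            \<longrightarrow> T \<in> closure AN_ops)"
  using assms(2) ess_spectrum_eq_if_closure_AN[of T] adj_in_closure_AN[of T]
    adj_in_closure_AN[of "adj T"] by (auto simp: adj_adj)

end
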